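(* Let $\langle \mathcal{P},T\rangle$ be an $EPT$ representation of a graph $G$. If $G$ has a $k$-gate as an induced subgraph, then $\langle \mathcal{P},T\rangle$ contains a multipie of size $k$ whose paths are in one-to-one correspondence with the vertices of the gate (the path $P_v$ corresponding to the vertex $v$).
   Context: All graphs are finite and simple. An $EPT$ representation of a graph $G$ is a pair $\langle \mathcal{P},T\rangle$ where $T$ is a tree and $\mathcal{P}=(P_v)_{v\in V(G)}$ is a family of subpaths of $T$ such that two distinct vertices $v,w$ are adjacent if and only if $E(P_v)\cap E(P_w)\neq\emptyset$. A clique is a maximal complete set of vertices. Gates are defined recursively: (i) every chordless cycle $C_n$ with $n\geq 4$ is a gate; (ii) if $H$ is a gate, $C$ and $C'$ are disjoint cliques of $H$, and $P=(v_1,\dots,v_l)$ with $l\geq 2$ is a chordless path vertex-disjoint from $H$, then the union of $H$ and $P$ together with all edges between $v_1$ and the vertices of $C$ and all edges between $v_l$ and the vertices of $C'$ is a gate; (iii) there are no other gates. A $k$-gate is a gate with exactly $k$ cliques. A star is a graph $K_{1,n}$; its edges are spokes; the claw is $K_{1,3}$. A path contains a spoke if the spoke is one of its edges. Three paths of $\mathcal{P}$ form a claw if there is a claw $Y$ subgraph of $T$ such that every pair of spokes of $Y$ is contained in one of the three paths. A multipie of size $k$ in $\langle\mathcal{P},T\rangle$ is a star subgraph of $T$ with center $q$ and neighbors $q_1,\dots,q_k$ together with a subfamily $\mathcal{P}'\subseteq\mathcal{P}$ such that: (1) every $P\in\mathcal{P}'$ satisfies $|V(P)\cap\{q_1,\dots,q_k\}|=2$;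 (2) for $i\neq j$, at most one $P\in\mathcal{P}'$ has $\{q_i,q_j\}\subseteq V(P)$; (3) for each $1\leq i\leq k$, at least two $P\in\mathcal{P}'$ have $\{q,q_i\}\subseteq V(P)$; (4) no three paths of $\mathcal{P}'$ form a claw. *)

theory Defs
  imports Main
begin

definition simple_graph :: "'a set \<Rightarrow> 'a set set \<Rightarrow> bool" where
  "simple_graph V E \<longleftrightarrow> finite V \<and> E \<subseteq> {{u, v} | u v. u \<in> V \<and> v \<in> V \<and> u \<noteq> v}"

definition path_edges :: "'b list \<Rightarrow> 'b set set" where
  "path_edges xs = {{xs ! i, xs ! Suc i} | i. Suc i < length xs}"

definition is_path :: "'b set \<Rightarrow> 'b set set \<Rightarrow> 'b list \<Rightarrow> bool" where
  "is_path VT ET xs \<longleftrightarrow> xs \<noteq> [] \<and> distinct xs \<and> set xs \<subseteq> VT \<and> path_edges xs \<subseteq> ET"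

definition connected_graph :: "'b set \<Rightarrow> 'b set set \<Rightarrow> bool" where
  "connected_graph VT ET \<longleftrightarrow>
     (\<forall>x\<in>VT. \<forall>y\<in>VT. \<exists>xs. is_path VT ET xs \<and> hd xs = x \<and> last xs = y)"

definition has_cycle :: "'b set \<Rightarrow> 'b set set \<Rightarrow> bool" where
  "has_cycle VT ET \<longleftrightarrow>
     (\<exists>xs. is_path VT ET xs \<and> length xs \<ge> 3 \<and> {last xs, hd xs} \<in> ET)"

definition is_tree :: "'b set \<Rightarrow> 'b set set \<Rightarrow> bool" where
  "is_tree VT ET \<longleftrightarrow> simple_graph VT ET \<and> VT \<noteq> {} \<and> connected_graph VT ET \<and> \<not> has_cycle VT ET"

definition EPT_rep :: "'a set \<Rightarrow> 'a set set \<Rightarrow> 'b set \<Rightarrow> 'b set set \<Rightarrow> ('a \<Rightarrow> 'b list) \<Rightarrow> bool" where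
  "EPT_rep V E VT ET P \<longleftrightarrow> is_tree VT ET \<and> (\<forall>v\<in>V. is_path VT ET (P v)) \<and>
     (\<forall>u\<in>V. \<forall>v\<in>V. u \<noteq> v \<longrightarrow> ({u, v} \<in> E \<longleftrightarrow> path_edges (P u) \<inter> path_edges (P v) \<noteq> {}))"

definition induced_edges :: "'a set set \<Rightarrow> 'a set \<Rightarrow> 'a set set" where
  "induced_edges E S = {e \<in> E. e \<subseteq> S}"

definition complete_set :: "'a set \<Rightarrow> 'a set set \<Rightarrow> 'a set \<Rightarrow> bool" where
  "complete_set V E K \<longleftrightarrow> K \<subseteq> V \<and> (\<forall>u\<in>K. \<forall>v\<in>K. u \<noteq> v \<longrightarrow> {u, v} \<in> E)"

definition is_clique :: "'a set \<Rightarrow> 'a set set \<Rightarrow> 'a set \<Rightarrow> bool" where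
  "is_clique V E K \<longleftrightarrow> complete_set V E K \<and> (\<forall>K'. complete_set V E K' \<and> K \<subseteq> K' \<longrightarrow> K' = K)"

definition cycle_graph :: "'a set \<Rightarrow> 'a set set \<Rightarrow> bool" where
  "cycle_graph V E \<longleftrightarrow> (\<exists>xs. distinct xs \<and> length xs \<ge> 4 \<and> set xs = V \<and>
      E = {{xs ! i, xs ! ((Suc i) mod length xs)} | i. i < length xs})"

inductive gate :: "'a set \<Rightarrow> 'a set set \<Rightarrow> bool" where
  cyc: "cycle_graph V E \<Longrightarrow> gate V E"
| ext: "\<lbrakk> gate V E; is_clique V E C; is_clique V E C'; C \<inter> C' = {};
          distinct ps; length ps \<ge> 2; set ps \<inter> V = {} \<rbrakk> \<Longrightarrow>
        gate (V \<union> set ps)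
             (E \<union> path_edges ps \<union> {{hd ps, c} | c. c \<in> C} \<union> {{last ps, c} | c. c \<in> C'})"

definition k_gate :: "nat \<Rightarrow> 'a set \<Rightarrow> 'a set set \<Rightarrow> bool" where
  "k_gate k V E \<longleftrightarrow> gate V E \<and> card {C. is_clique V E C} = k"

definition form_claw :: "'b set set \<Rightarrow> 'b list \<Rightarrow> 'b list \<Rightarrow> 'b list \<Rightarrow> bool" where
  "form_claw ET P1 P2 P3 \<longleftrightarrow>
    (\<exists>c a b d. distinct [c, a, b, d] \<and> {c, a} \<in> ET \<and> {c, b} \<in> ET \<and> {c, d} \<in> ET \<and>
      (\<forall>s\<in>{{c, a}, {c, b}, {c, d}}. \<forall>t\<in>{{c, a}, {c, b}, {c, d}}. s \<noteq> t \<longrightarrow>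
          (\<exists>X\<in>{P1, P2, P3}. s \<in> path_edges X \<and> t \<in> path_edges X)))"

text \<open>Multipie with center q, neighbour set Q (size = card Q) and subfamily (P v)_{v \<in> S}.\<close>
definition multipie :: "'b set \<Rightarrow> 'b set set \<Rightarrow> ('a \<Rightarrow> 'b list) \<Rightarrow> 'a set \<Rightarrow> 'b \<Rightarrow> 'b set \<Rightarrow> bool" where
  "multipie VT ET P S q Q \<longleftrightarrow>
     q \<in> VT \<and> finite Q \<and> (\<forall>x\<in>Q. {q, x} \<in> ET) \<and>
     (\<forall>v\<in>S. card (set (P v) \<inter> Q) = 2) \<and>
     (\<forall>a\<in>Q. \<forall>b\<in>Q. a \<noteq> b \<longrightarrow> card {v\<in>S. {a, b} \<subseteq> set (P v)} \<le> 1) \<and>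
     (\<forall>a\<in>Q. card {v\<in>S. {q, a} \<subseteq> set (P v)} \<ge> 2) \<and>
     (\<forall>u\<in>S. \<forall>v\<in>S. \<forall>w\<in>S. distinct [u, v, w] \<longrightarrow> \<not> form_claw ET (P u) (P v) (P w))"

end

theory Submission
  imports Defs
begin

text \<open>A gate is the line graph of a triangle-free, 2-connected root graph: a chordless cycle is the line graph of
  a cycle of length at least 4, and joining two disjoint cliques by a path adds an ear between two
  non-adjacent vertices of the root graph. The cliques of the gate are the stars of the root graph.

  The paths through a fixed tree edge are pairwise adjacent, so their vertices lie in one star. By
  2-connectedness the remaining vertices of the gate induce a connected graph, hence the remaining paths
  lie on one side of the tree edge. Orienting every tree edge towards that side, the tree has a sink \<open>q\<close>. No
  path can miss \<open>q\<close>, and two paths of adjacent vertices share an edge at \<open>q\<close>. Since each path has at most two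
  edges at \<open>q\<close> and the root graph is triangle-free, each star consists of exactly the paths through one
  edge at \<open>q\<close>; these edges are the spokes of the multipie.\<close>

subsection \<open>Edge cuts in trees\<close>

text \<open>Reachability depends on the edge set alone, so deleting a tree edge is a plain set
  difference such as \<open>ET - {{a, b}}\<close>. Membership in \<open>VT\<close> is recovered
  separately where it matters.\<close>

definition reach :: "'b set set \<Rightarrow> ('b \<times> 'b) set" where
  "reach E = {(x, y). {x, y} \<in> E}\<^sup>*"

lemma reach_refl [simp]: "(x, x) \<in> reach E"
  by (simp add: reach_def)

lemma reach_trans: "(x, y) \<in> reach E \<Longrightarrow> (y, z) \<in> reach E \<Longrightarrow> (x, z) \<in> reach E"
  unfolding reach_def by (rule rtrancl_trans)

lemma reach_edge: "{x, y} \<in> E \<Longrightarrow> (x, y) \<in> reach E"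
  unfolding reach_def by auto

lemma reach_sym: "(x, y) \<in> reach E \<Longrightarrow> (y, x) \<in> reach E"
  unfolding reach_def
  by (rule symD[OF sym_rtrancl]) (auto intro!: symI simp: insert_commute)

lemma reach_mono: "E \<subseteq> E' \<Longrightarrow> (x, y) \<in> reach E \<Longrightarrow> (x, y) \<in> reach E'"
  unfolding reach_def by (rule rtrancl_mono[THEN subsetD, rotated]) auto

lemma reach_induct [consumes 1, case_names refl step]:
  assumes "(x, y) \<in> reach E" "Q x"
    and "\<And>z w. (x, z) \<in> reach E \<Longrightarrow> {z, w} \<in> E \<Longrightarrow> Q z \<Longrightarrow> Q w"
  shows "Q y"
  using assms(1) unfolding reach_def
  by (induction rule: rtrancl_induct) (use assms(2,3) in \<open>auto simp: reach_def\<close>)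

lemma path_edgesI: "Suc i < length xs \<Longrightarrow> {xs ! i, xs ! Suc i} \<in> path_edges xs"
  unfolding path_edges_def by auto

lemma path_edges_subset: "e \<in> path_edges xs \<Longrightarrow> e \<subseteq> set xs"
  unfolding path_edges_def by auto

lemma path_edges_take: "path_edges (take k xs) \<subseteq> path_edges xs"
  unfolding path_edges_def by fastforce

lemma path_edges_snoc:
  assumes "xs \<noteq> []"
  shows "path_edges (xs @ [w]) \<subseteq> insert {last xs, w} (path_edges xs)"
proof
  fix e assume "e \<in> path_edges (xs @ [w])"
  then obtain i where i: "Suc i < length (xs @ [w])" "e = {(xs @ [w]) ! i, (xs @ [w]) ! Suc i}"
    unfolding path_edges_def by blast
  show "e \<in> insert {last xs, w} (path_edges xs)"
  proof (cases "Suc i < length xs")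
    case True
    then show ?thesis using i by (auto simp: nth_append path_edges_def)
  next
    case False
    with i have "length xs = Suc i" by simp
    then show ?thesis using i assms by (simp add: nth_append last_conv_nth)
  qed
qed

lemma reach_nth:
  assumes "i < length xs"
  shows "(xs ! 0, xs ! i) \<in> reach (path_edges xs)"
  using assms
proof (induction i)
  case (Suc i)
  then show ?case
    using path_edgesI[of i xs] reach_edge reach_trans by fastforce
qed simp

lemma reach_in_path:
  assumes "x \<in> set xs" "y \<in> set xs"
  shows "(x, y) \<in> reach (path_edges xs)"
  using assms reach_nth reach_sym reach_trans by (metis in_set_conv_nth)

text \<open>The walk is made repetition-free as it grows: a new vertex is appended, while a vertex
  met before cuts the path back to its earlier position.\<close>

lemma reach_imp_path:
  assumes "(x, y) \<in> reach E"
  shows "\<exists>xs. xs \<noteq> [] \<and> distinct xs \<and> path_edges xs \<subseteq> E \<and> hd xs = x \<and> last xs = y"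
  using assms
proof (induction rule: reach_induct)
  case refl
  show ?case by (rule exI[of _ "[x]"]) (simp add: path_edges_def)
next
  case (step z w)
  then obtain xs where xs: "xs \<noteq> []" "distinct xs" "path_edges xs \<subseteq> E" "hd xs = x" "last xs = z"
    by blast
  show ?case
  proof (cases "w \<in> set xs")
    case True
    then obtain i where i: "i < length xs" "xs ! i = w" by (auto simp: in_set_conv_nth)
    have "last (take (Suc i) xs) = w" using i by (simp add: take_Suc_conv_app_nth)
    then show ?thesis using xs i path_edges_take[of "Suc i" xs]
      by (intro exI[of _ "take (Suc i) xs"]) auto
  next
    case False
    then show ?thesis using xs step(2) path_edges_snoc[of xs w]
      by (intro exI[of _ "xs @ [w]"]) auto
  qed
qed

text \<open>Without repetition \<open>c\<close> has a single position in the list, and its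
  neighbours along the path stand directly before and after it.\<close>

lemma path_degree_le_2:
  assumes "distinct xs" "{c, a} \<in> path_edges xs" "{c, b} \<in> path_edges xs" "{c, d} \<in> path_edges xs"
    and "distinct [a, b, d]"
  shows False
proof -
  have nbr: "\<exists>i j. xs ! i = c \<and> xs ! j = z \<and> i < length xs \<and> j < length xs \<and> (j = Suc i \<or> i = Suc j)"
    if "{c, z} \<in> path_edges xs" for z
    using that unfolding path_edges_def by (force simp: doubleton_eq_iff)
  obtain i where i: "xs ! i = c" "i < length xs" using nbr assms(2) by blast
  \<comment> \<open>For \<open>i = 0\<close> the term \<open>xs ! (i - 1)\<close> is
    \<open>c\<close> itself. This does no harm: all that counts is that \<open>a\<close>,
    \<open>b\<close>, \<open>d\<close> lie in a set of at most two elements.\<close>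
  have "z \<in> {xs ! Suc i, xs ! (i - 1)}" if "{c, z} \<in> path_edges xs" for z
    using nbr[OF that] i assms(1) by (auto simp: nth_eq_iff_index_eq)
  with assms(2-5) show False by auto
qed

lemma tree_edge:
  assumes "is_tree VT ET" "{a, b} \<in> ET"
  shows "a \<in> VT" "b \<in> VT" "a \<noteq> b"
  using assms unfolding is_tree_def simple_graph_def by (auto simp: doubleton_eq_iff)

text \<open>A path from \<open>a\<close> to \<open>b\<close> that avoids the edge
  \<open>{a, b}\<close> has at least three vertices, and that edge closes it to a cycle.\<close>

lemma tree_edge_cut:
  assumes T: "is_tree VT ET" and ab: "{a, b} \<in> ET"
  shows "(a, b) \<notin> reach (ET - {{a, b}})"
proof
  assume "(a, b) \<in> reach (ET - {{a, b}})"
  then obtain xs where xs: "xs \<noteq> []" "distinct xs" "path_edges xs \<subseteq> ET - {{a, b}}"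
    "hd xs = a" "last xs = b"
    using reach_imp_path[OF \<open>(a, b) \<in> reach (ET - {{a, b}})\<close>] by iprover
  have "a \<noteq> b" using tree_edge[OF T ab] by simp
  have "length xs \<noteq> 1" using xs \<open>a \<noteq> b\<close> by (auto simp: length_Suc_conv)
  moreover have "length xs \<noteq> 2"
  proof
    assume "length xs = 2"
    then obtain u v where "xs = [u, v]" by (auto simp: length_Suc_conv numeral_2_eq_2)
    then show False using xs path_edgesI[of 0 xs] by auto
  qed
  moreover have "length xs \<noteq> 0" using xs by simp
  ultimately have len: "length xs \<ge> 3" by linarith
  \<comment> \<open>\<open>reach_imp_path\<close> says nothing about vertices. With at least three
    entries, each entry lies on an edge of the path, and the ends of tree edges are in
    \<open>VT\<close>.\<close>
  have "set xs \<subseteq> VT"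
  proof
    fix z assume "z \<in> set xs"
    then obtain i where i: "i < length xs" "z = xs ! i" by (auto simp: in_set_conv_nth)
    then have "(Suc i < length xs) \<or> (\<exists>j. i = Suc j)" using len by (cases i) auto
    then obtain w where "{z, w} \<in> path_edges xs"
      using path_edgesI[of _ xs] i by (metis insert_commute)
    then show "z \<in> VT" using tree_edge(1)[OF T] xs(3) by blast
  qed
  then have "has_cycle VT ET"
    unfolding has_cycle_def is_path_def using xs len ab by (intro exI[of _ xs]) (auto simp: insert_commute)
  then show False using T by (simp add: is_tree_def)
qed

lemma tree_reach:
  assumes "is_tree VT ET" "x \<in> VT" "y \<in> VT"
  shows "(x, y) \<in> reach ET"
proof -
  obtain xs where "is_path VT ET xs" "hd xs = x" "last xs = y"
    using assms unfolding is_tree_def connected_graph_def by blast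
  then show ?thesis
    unfolding is_path_def by (metis reach_in_path hd_in_set last_in_set reach_mono)
qed

text \<open>Along a walk from \<open>a\<close>, each use of the deleted edge ends in
  \<open>a\<close> or \<open>b\<close>, so the walk can be restarted there.\<close>

lemma tree_edge_sides:
  assumes "is_tree VT ET" "{a, b} \<in> ET" "z \<in> VT"
  shows "(a, z) \<in> reach (ET - {{a, b}}) \<or> (b, z) \<in> reach (ET - {{a, b}})"
proof -
  have "(a, z) \<in> reach ET" using assms tree_reach tree_edge(1) by metis
  then show ?thesis
  proof (induction rule: reach_induct)
    case (step y w)
    show ?case
    proof (cases "{y, w} = {a, b}")
      case True
      then have "w = a \<or> w = b" by auto
      then show ?thesis by auto
    next
      case False
      then have "(y, w) \<in> reach (ET - {{a, b}})" using step by (intro reach_edge) auto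
      then show ?thesis using step reach_trans by metis
    qed
  qed simp
qed

lemma path_same_side:
  assumes "is_path VT ET xs" "t \<notin> path_edges xs" "x \<in> set xs" "y \<in> set xs"
  shows "(x, y) \<in> reach (ET - {t})"
  using reach_in_path[OF assms(3,4)] by (rule reach_mono[rotated]) (use assms in \<open>auto simp: is_path_def\<close>)

text \<open>Otherwise the path would connect \<open>a\<close> and \<open>b\<close> after deletion of
  the edge between them, against \<open>tree_edge_cut\<close>.\<close>

lemma tree_path_edge:
  assumes "is_tree VT ET" "is_path VT ET xs" "{a, b} \<in> ET" "a \<in> set xs" "b \<in> set xs"
  shows "{a, b} \<in> path_edges xs"
  using path_same_side[OF assms(2) _ assms(4,5)] tree_edge_cut[OF assms(1,3)] by blast

text \<open>\<open>{x, a}\<close> is the first edge on the way from \<open>x\<close> to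
  \<open>y\<close>. It is found by following a walk and choosing \<open>a\<close> anew whenever the
  walk leaves \<open>x\<close>.\<close>

lemma tree_first_edge:
  assumes "is_tree VT ET" "x \<in> VT" "y \<in> VT" "x \<noteq> y"
  shows "\<exists>a. {x, a} \<in> ET \<and> (a, y) \<in> reach (ET - {{x, a}})"
proof -
  have "(x, y) \<in> reach ET" using assms tree_reach by metis
  then have "y = x \<or> (\<exists>a. {x, a} \<in> ET \<and> (a, y) \<in> reach (ET - {{x, a}}))"
  proof (induction rule: reach_induct)
    case (step z w)
    show ?case
    proof (cases "w = x \<or> z = x")
      case True
      then show ?thesis using step(2) by auto
    next
      case False
      with step obtain a where a: "{x, a} \<in> ET" "(a, z) \<in> reach (ET - {{x, a}})" by blast
      have "{z, w} \<in> ET - {{x, a}}" using False step by (auto simp: doubleton_eq_iff)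
      then show ?thesis using a reach_edge reach_trans by metis
    qed
  qed simp
  with assms show ?thesis by blast
qed

text \<open>The first edge from \<open>x\<close> towards \<open>y\<close> separates the two, so
  every path containing both must use it. This turns two shared vertices into a shared edge at a
  prescribed vertex.\<close>

lemma tree_common_first_edge:
  assumes T: "is_tree VT ET" and "x \<in> VT" "y \<in> VT" "x \<noteq> y"
  shows "\<exists>a. {x, a} \<in> ET \<and>
    (\<forall>xs. is_path VT ET xs \<longrightarrow> x \<in> set xs \<longrightarrow> y \<in> set xs \<longrightarrow> {x, a} \<in> path_edges xs)"
proof -
  obtain a where a: "{x, a} \<in> ET" "(a, y) \<in> reach (ET - {{x, a}})"
    using tree_first_edge[OF assms] by blast
  have "{x, a} \<in> path_edges xs" if "is_path VT ET xs" "x \<in> set xs" "y \<in> set xs" for xs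
  proof (rule ccontr)
    assume "{x, a} \<notin> path_edges xs"
    then have "(x, y) \<in> reach (ET - {{x, a}})" using path_same_side that by metis
    then show False using a tree_edge_cut[OF T a(1)] reach_sym reach_trans by metis
  qed
  with a show ?thesis by blast
qed

text \<open>Read \<open>D a b\<close> as an orientation from \<open>a\<close> to \<open>b\<close>.
  Among all oriented edges take one whose head lies in a smallest component after deletion of the
  edge. Its head is a sink, since an edge leaving it would have a strictly smaller head
  component.\<close>

lemma tree_orientation_sink:
  assumes T: "is_tree VT ET"
    and total: "\<And>a b. {a, b} \<in> ET \<Longrightarrow> D a b \<or> D b a"
    and asym: "\<And>a b. {a, b} \<in> ET \<Longrightarrow> D a b \<Longrightarrow> \<not> D b a"
  shows "\<exists>q\<in>VT. \<forall>a. {q, a} \<in> ET \<longrightarrow> D a q"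
proof (cases "ET = {}")
  case True
  then show ?thesis using T by (auto simp: is_tree_def)
next
  case False
  define side where "side a b = {z \<in> VT. (b, z) \<in> reach (ET - {{a, b}})}" for a b
  have fin: "finite VT" using T by (simp add: is_tree_def simple_graph_def)
  obtain t where "t \<in> ET" using False by blast
  then obtain a0 b0 where "{a0, b0} \<in> ET"
    using T unfolding is_tree_def simple_graph_def by blast
  with total have "\<exists>p. {fst p, snd p} \<in> ET \<and> D (fst p) (snd p)"
    by (metis insert_commute fst_conv snd_conv)
  then obtain p where p: "{fst p, snd p} \<in> ET \<and> D (fst p) (snd p)"
    and pmin: "\<And>r. {fst r, snd r} \<in> ET \<and> D (fst r) (snd r) \<Longrightarrow>
      card (side (fst p) (snd p)) \<le> card (side (fst r) (snd r))"
    using ex_has_least_nat[of "\<lambda>p. {fst p, snd p} \<in> ET \<and> D (fst p) (snd p)" _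
        "\<lambda>p. card (side (fst p) (snd p))"] by blast
  obtain a b where ab: "p = (a, b)" by (cases p)
  have b: "{a, b} \<in> ET" "D a b" using p ab by auto
  have "D c b" if bc: "{b, c} \<in> ET" for c
  proof (rule ccontr)
    assume "\<not> D c b"
    then have D: "D b c" using total bc by blast
    have ca: "c \<noteq> a" using D b asym bc by (metis insert_commute)
    have nb: "(c, b) \<notin> reach (ET - {{b, c}})"
      using tree_edge_cut[OF T bc] reach_sym by metis
    \<comment> \<open>The component beyond \<open>c\<close> does not contain \<open>b\<close>, so
      none of its edges is \<open>{a, b}\<close> and it survives the deletion of that edge
      instead.\<close>
    have sub: "(c, z) \<in> reach (ET - {{a, b}})" if "(c, z) \<in> reach (ET - {{b, c}})" for z
      using that
    proof (induction rule: reach_induct)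
      case (step z w)
      have "(c, w) \<in> reach (ET - {{b, c}})"
        by (rule reach_trans[OF step(1) reach_edge[OF step(2)]])
      then have "z \<noteq> b" "w \<noteq> b" using step(1) nb by auto
      then have "{z, w} \<in> ET - {{a, b}}" using step(2) by (simp add: doubleton_eq_iff)
      then show ?case by (rule reach_trans[OF step(3) reach_edge])
    qed simp
    have "{b, c} \<in> ET - {{a, b}}" using bc ca by (auto simp: doubleton_eq_iff)
    then have "(b, z) \<in> reach (ET - {{a, b}})" if "(c, z) \<in> reach (ET - {{b, c}})" for z
      using reach_trans[OF reach_edge sub[OF that]] by metis
    then have "side b c \<subseteq> side a b" unfolding side_def by (intro Collect_mono) simp
    \<comment> \<open>The vertex \<open>b\<close> witnesses that the inclusion is strict.\<close>
    moreover have "b \<in> side a b" "b \<notin> side b c"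
      using nb tree_edge[OF T bc] unfolding side_def by auto
    ultimately have "card (side b c) < card (side a b)"
      using fin by (intro psubset_card_mono) (auto simp: side_def)
    then show False using pmin[of "(b, c)"] ab bc D by simp
  qed
  then show ?thesis using tree_edge[OF T b(1)] by blast
qed

subsection \<open>Root graphs and ears\<close>

text \<open>Connectedness after deleting a vertex \<open>x\<close> is stated through two-colourings: every colouring that is
  constant along the edges avoiding \<open>x\<close> is constant.\<close>

definition root_graph :: "'c set \<Rightarrow> 'c set set \<Rightarrow> bool" where
  "root_graph W F \<longleftrightarrow> finite W \<and> card W \<ge> 3 \<and>
     (\<forall>e\<in>F. \<exists>a\<in>W. \<exists>b\<in>W. a \<noteq> b \<and> e = {a, b}) \<and>
     (\<forall>a b c. {a, b} \<in> F \<longrightarrow> {b, c} \<in> F \<longrightarrow> {a, c} \<notin> F) \<and>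
     (\<forall>x\<in>W. \<exists>a b. a \<noteq> b \<and> {x, a} \<in> F \<and> {x, b} \<in> F) \<and>
     (\<forall>x\<in>W. \<forall>f :: 'c \<Rightarrow> bool.
        (\<forall>a b. {a, b} \<in> F \<longrightarrow> a \<noteq> x \<longrightarrow> b \<noteq> x \<longrightarrow> f a = f b) \<longrightarrow>
        (\<forall>a\<in>W. \<forall>b\<in>W. a \<noteq> x \<longrightarrow> b \<noteq> x \<longrightarrow> f a = f b))"

lemma
  assumes "root_graph W F"
  shows root_finite: "finite W"
    and root_card: "card W \<ge> 3"
    and root_edge: "e \<in> F \<Longrightarrow> \<exists>a\<in>W. \<exists>b\<in>W. a \<noteq> b \<and> e = {a, b}"
    and root_triangle: "{a, b} \<in> F \<Longrightarrow> {b, c} \<in> F \<Longrightarrow> {a, c} \<notin> F"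
    and root_degree: "x \<in> W \<Longrightarrow> \<exists>a b. a \<noteq> b \<and> {x, a} \<in> F \<and> {x, b} \<in> F"
    and root_connected: "x \<in> W \<Longrightarrow> (\<And>a b. {a, b} \<in> F \<Longrightarrow> a \<noteq> x \<Longrightarrow> b \<noteq> x \<Longrightarrow> f a = f b)
      \<Longrightarrow> a \<in> W \<Longrightarrow> b \<in> W \<Longrightarrow> a \<noteq> x \<Longrightarrow> b \<noteq> x \<Longrightarrow> (f :: _ \<Rightarrow> bool) a = f b"
proof -
  note R = assms[unfolded root_graph_def]
  show "finite W" "card W \<ge> 3" using R by auto
  show "e \<in> F \<Longrightarrow> \<exists>a\<in>W. \<exists>b\<in>W. a \<noteq> b \<and> e = {a, b}"
    using R[THEN conjunct2, THEN conjunct2, THEN conjunct1] by blast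
  show "{a, b} \<in> F \<Longrightarrow> {b, c} \<in> F \<Longrightarrow> {a, c} \<notin> F"
    using R[THEN conjunct2, THEN conjunct2, THEN conjunct2, THEN conjunct1] by blast
  show "x \<in> W \<Longrightarrow> \<exists>a b. a \<noteq> b \<and> {x, a} \<in> F \<and> {x, b} \<in> F"
    using R[THEN conjunct2, THEN conjunct2, THEN conjunct2, THEN conjunct2, THEN conjunct1] by blast
  show "f a = f b" if "x \<in> W" "\<And>a b. {a, b} \<in> F \<Longrightarrow> a \<noteq> x \<Longrightarrow> b \<noteq> x \<Longrightarrow> f a = f b"
    "a \<in> W" "b \<in> W" "a \<noteq> x" "b \<noteq> x" for x a b and f :: "_ \<Rightarrow> bool"
    using R[THEN conjunct2, THEN conjunct2, THEN conjunct2, THEN conjunct2, THEN conjunct2,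
        rule_format, of x f a b] that by blast
qed

lemma root_edge_pair:
  assumes "root_graph W F" "{a, b} \<in> F"
  shows "a \<in> W" "b \<in> W" "a \<noteq> b"
  using root_edge[OF assms] by (auto simp: doubleton_eq_iff)

lemma root_graph_cycle:
  assumes n: "n \<ge> 4"
  shows "root_graph {..<n} {{i, Suc i mod n} | i. i < n}" (is "root_graph _ ?F")
proof -
  have adj: "{a, b} \<in> ?F \<longleftrightarrow> a < n \<and> b < n \<and>
      (b = Suc a \<or> a = Suc b \<or> (a = 0 \<and> Suc b = n) \<or> (b = 0 \<and> Suc a = n))" for a b
  proof -
    have "{a, b} \<in> ?F \<longleftrightarrow> (a < n \<and> b = Suc a mod n) \<or> (b < n \<and> a = Suc b mod n)"
      by (auto simp: doubleton_eq_iff)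
    also have "\<dots> \<longleftrightarrow> a < n \<and> b < n \<and>
        (b = Suc a \<or> a = Suc b \<or> (a = 0 \<and> Suc b = n) \<or> (b = 0 \<and> Suc a = n))"
      using n by (auto simp: mod_Suc)
    finally show ?thesis .
  qed
  have conn: "f a = f b"
    if f: "\<forall>a b. {a, b} \<in> ?F \<longrightarrow> a \<noteq> x \<longrightarrow> b \<noteq> x \<longrightarrow> f a = f b"
      and x: "x < n" and ab: "a < n" "b < n" "a \<noteq> x" "b \<noteq> x"
    for f :: "nat \<Rightarrow> bool" and x a b
  proof -
    have st: "f i = f (Suc i)" if "Suc i < n" "i \<noteq> x" "Suc i \<noteq> x" for i
      using f[rule_format, of i "Suc i"] that adj by auto
    \<comment> \<open>Deleting \<open>x\<close> splits the cycle into the vertices below and above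
      \<open>x\<close>. \<open>low\<close> links the former to \<open>0\<close>, \<open>high\<close>
      links the latter to \<open>n - 1\<close> by counting down, and \<open>wrap\<close> uses the
      closing edge between \<open>n - 1\<close> and \<open>0\<close>.\<close>
    have low: "i < x \<longrightarrow> f i = f 0" for i
      by (induction i) (use st x in auto)
    have high: "x < n - 1 - i \<longrightarrow> f (n - 1 - i) = f (n - 1)" for i
    proof (induction i)
      case (Suc i)
      then show ?case
        using st[of "n - 1 - Suc i"] x by (auto simp: Suc_diff_Suc)
    qed simp
    have wrap: "x \<noteq> 0 \<Longrightarrow> x \<noteq> n - 1 \<Longrightarrow> f 0 = f (n - 1)"
      using f[rule_format, of 0 "n - 1"] n adj by auto
    have up: "f i = f (n - 1)" if "i < n" "x < i" for i
      using high[of "n - 1 - i"] that by auto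
    \<comment> \<open>The reference vertex is \<open>0\<close>, unless \<open>0\<close> is the
      deleted vertex.\<close>
    have "f i = f (if x = 0 then n - 1 else 0)" if "i < n" "i \<noteq> x" for i
      using low[of i] up[of i] wrap that by (cases "i < x") auto
    with ab show ?thesis by metis
  qed
  have edges: "\<exists>a\<in>{..<n}. \<exists>b\<in>{..<n}. a \<noteq> b \<and> e = {a, b}" if "e \<in> ?F" for e
  proof -
    from that obtain i where "i < n" "e = {i, Suc i mod n}" by blast
    moreover have "i \<noteq> Suc i mod n" using n \<open>i < n\<close> by (auto simp: mod_Suc)
    ultimately show ?thesis using n by fastforce
  qed
  have tri: "{a, b} \<in> ?F \<Longrightarrow> {b, c} \<in> ?F \<Longrightarrow> {a, c} \<notin> ?F" for a b c
    unfolding adj using n by linarith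
  have deg: "\<exists>a b. a \<noteq> b \<and> {x, a} \<in> ?F \<and> {x, b} \<in> ?F" if "x < n" for x
  proof -
    have "{x, if Suc x = n then 0 else Suc x} \<in> ?F" "{x, if x = 0 then n - 1 else x - 1} \<in> ?F"
      unfolding adj using that n by auto
    moreover have "(if Suc x = n then 0 else Suc x) \<noteq> (if x = 0 then n - 1 else x - 1)"
      using that n by auto
    ultimately show ?thesis by blast
  qed
  show ?thesis
    unfolding root_graph_def
  proof (intro conjI ballI allI impI)
    fix x a b and f :: "nat \<Rightarrow> bool"
    assume "\<forall>a b. {a, b} \<in> ?F \<longrightarrow> a \<noteq> x \<longrightarrow> b \<noteq> x \<longrightarrow> f a = f b"
      and "x \<in> {..<n}" "a \<in> {..<n}" "b \<in> {..<n}" "a \<noteq> x" "b \<noteq> x"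
    then show "f a = f b" by (intro conn) simp_all
  next
    fix e assume "e \<in> ?F"
    then show "\<exists>a\<in>{..<n}. \<exists>b\<in>{..<n}. a \<noteq> b \<and> e = {a, b}" by (rule edges)
  next
    fix a b c assume "{a, b} \<in> ?F" "{b, c} \<in> ?F"
    then show "{a, c} \<notin> ?F" by (rule tri)
  next
    fix x assume "x \<in> {..<n}"
    then show "\<exists>a b. a \<noteq> b \<and> {x, a} \<in> ?F \<and> {x, b} \<in> ?F" by (intro deg) simp
  qed (use n in simp_all)
qed

text \<open>A triangle through an inner ear vertex would need the two ends of the ear to be
  adjacent. Deleting a vertex cuts the ear into at most two pieces, each still attached to
  \<open>W\<close> at an end of the ear.\<close>

lemma root_graph_ear:
  assumes R: "root_graph W F"
    and ys: "distinct ys" "length ys \<ge> 3" "set ys \<inter> W = {hd ys, last ys}" "{hd ys, last ys} \<notin> F"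
  shows "root_graph (W \<union> set ys) (F \<union> path_edges ys)"
proof -
  define l where "l = length ys - 1"
  have l: "l \<ge> 2" "length ys = Suc l" using ys by (auto simp: l_def)
  have ne: "ys \<noteq> []" using ys by auto
  have hd: "hd ys = ys ! 0" and la: "last ys = ys ! l"
    using ne by (auto simp: hd_conv_nth last_conv_nth l_def)
  have inj: "ys ! i = ys ! j \<longleftrightarrow> i = j" if "i \<le> l" "j \<le> l" for i j
    using ys(1) l that by (simp add: nth_eq_iff_index_eq)
  have inW: "ys ! i \<in> W \<longleftrightarrow> i = 0 \<or> i = l" if "i \<le> l" for i
  proof -
    have "ys ! i \<in> set ys" using that l by auto
    then have "ys ! i \<in> W \<longleftrightarrow> ys ! i \<in> {ys ! 0, ys ! l}" using ys(3) hd la by auto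
    then show ?thesis using inj that by auto
  qed
  have pe: "{a, b} \<in> path_edges ys \<longleftrightarrow>
      (\<exists>i<l. (a = ys ! i \<and> b = ys ! Suc i) \<or> (b = ys ! i \<and> a = ys ! Suc i))" for a b
    unfolding path_edges_def l(2) by (auto simp: doubleton_eq_iff)
  have peI: "{ys ! i, ys ! j} \<in> path_edges ys \<longleftrightarrow> i = Suc j \<or> j = Suc i"
    if "i \<le> l" "j \<le> l" for i j
    unfolding pe using that inj by (metis Suc_leI Suc_le_lessD less_imp_le)
  have fresh: "\<exists>i. 0 < i \<and> i < l \<and> (a = ys ! i \<or> b = ys ! i)" if "{a, b} \<in> path_edges ys" for a b
  proof -
    from that obtain i where i: "i < l" "{a, b} = {ys ! i, ys ! Suc i}" unfolding pe by auto
    show ?thesis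
    proof (cases "i = 0")
      case True then show ?thesis using i l by (intro exI[of _ 1]) (auto simp: doubleton_eq_iff)
    next
      case False then show ?thesis using i by (intro exI[of _ i]) (auto simp: doubleton_eq_iff)
    qed
  qed
  have notF: "{a, b} \<notin> F" if "a = ys ! i" "0 < i" "i < l" for a b i
    using root_edge_pair[OF R, of a b] inW[of i] that by auto
  have mid: "\<exists>j\<le>l. b = ys ! j \<and> (i = Suc j \<or> j = Suc i)"
    if "{a, b} \<in> F \<union> path_edges ys" "a = ys ! i" "0 < i" "i < l" for a b i
  proof -
    have "{a, b} \<in> path_edges ys" using that notF by blast
    then obtain j where j: "j < l" "(a = ys ! j \<and> b = ys ! Suc j) \<or> (b = ys ! j \<and> a = ys ! Suc j)"
      unfolding pe by blast
    then show ?thesis using inj[of i j] inj[of i "Suc j"] that by (metis Suc_leI less_imp_le)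
  qed
  \<comment> \<open>The neighbours \<open>b\<close> and \<open>c\<close> of an inner ear vertex have
    positions that are equal or differ by two, so \<open>{b, c}\<close> is not an ear edge. As an
    edge of \<open>F\<close> it could only join the two ends of the ear.\<close>
  have tri_mid: False
    if h: "{a, b} \<in> F \<union> path_edges ys" "{a, c} \<in> F \<union> path_edges ys" "{b, c} \<in> F \<union> path_edges ys"
      and a: "a = ys ! i" "0 < i" "i < l" for a b c i
  proof -
    obtain j where j: "j \<le> l" "b = ys ! j" "i = Suc j \<or> j = Suc i" using mid[OF h(1) a] by blast
    obtain k where k: "k \<le> l" "c = ys ! k" "i = Suc k \<or> k = Suc i" using mid[OF h(2) a] by blast
    have "{b, c} \<notin> path_edges ys" using peI j k by auto
    then have bc: "{b, c} \<in> F" using h by blast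
    then have "b \<in> W" "c \<in> W" "b \<noteq> c" using root_edge_pair[OF R] by auto
    then have "{b, c} = {hd ys, last ys}" using inW j k hd la by auto
    then show False using bc ys by simp
  qed
  have tri: "{a, c} \<notin> F \<union> path_edges ys"
    if h: "{a, b} \<in> F \<union> path_edges ys" "{b, c} \<in> F \<union> path_edges ys" for a b c
  proof
    assume h3: "{a, c} \<in> F \<union> path_edges ys"
    have sw: "{x, y} \<in> F \<union> path_edges ys \<Longrightarrow> {y, x} \<in> F \<union> path_edges ys" for x y
      by (simp add: insert_commute)
    show False
    proof (cases "\<exists>i. 0 < i \<and> i < l \<and> (a = ys ! i \<or> b = ys ! i \<or> c = ys ! i)")
      case True
      then show False using tri_mid h h3 sw by metis
    next
      case False
      then have "{a, b} \<in> F" "{b, c} \<in> F" "{a, c} \<in> F" using h h3 fresh by blast+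
      then show False using root_triangle[OF R] by blast
    qed
  qed
  have deg: "\<exists>a b. a \<noteq> b \<and> {x, a} \<in> F \<union> path_edges ys \<and> {x, b} \<in> F \<union> path_edges ys"
    if x: "x \<in> W \<union> set ys" for x
  proof (cases "x \<in> W")
    case True
    then show ?thesis using root_degree[OF R] by blast
  next
    case False
    then obtain i where i: "i \<le> l" "x = ys ! i" using x l by (auto simp: in_set_conv_nth less_Suc_eq_le)
    then have "0 < i" "i < l" using inW[of i] False by auto
    then have "{x, ys ! (i - 1)} \<in> path_edges ys" "{x, ys ! Suc i} \<in> path_edges ys"
      "ys ! (i - 1) \<noteq> ys ! Suc i"
      using i peI inj by auto
    then show ?thesis by blast
  qed
  have edges: "\<exists>a\<in>W \<union> set ys. \<exists>b\<in>W \<union> set ys. a \<noteq> b \<and> e = {a, b}" if e: "e \<in> F \<union> path_edges ys" for e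
  proof (cases "e \<in> F")
    case True
    then show ?thesis using root_edge[OF R] by blast
  next
    case False
    then obtain i where "i < l" "e = {ys ! i, ys ! Suc i}" using e l unfolding path_edges_def by auto
    moreover have "ys ! i \<in> set ys" "ys ! Suc i \<in> set ys" "ys ! i \<noteq> ys ! Suc i"
      using \<open>i < l\<close> l inj by auto
    ultimately show ?thesis by blast
  qed
  have conn: "f a = f b"
    if f: "\<forall>a b. {a, b} \<in> F \<union> path_edges ys \<longrightarrow> a \<noteq> x \<longrightarrow> b \<noteq> x \<longrightarrow> f a = f b"
      and x: "x \<in> W \<union> set ys" and ab: "a \<in> W \<union> set ys" "b \<in> W \<union> set ys" "a \<noteq> x" "b \<noteq> x"
    for f :: "_ \<Rightarrow> bool" and x a b
  proof -
    have old: "f u = f v" if uv: "u \<in> W" "v \<in> W" "u \<noteq> x" "v \<noteq> x" for u v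
    proof -
      \<comment> \<open>When \<open>x\<close> is an inner ear vertex, nothing of the old graph is
        deleted. Deleting an arbitrary third vertex \<open>z\<close> of \<open>W\<close> makes the
        old connectedness property applicable.\<close>
      have "\<exists>z\<in>W. z \<noteq> u \<and> z \<noteq> v \<and> (x \<in> W \<longrightarrow> z = x)"
      proof (cases "x \<in> W")
        case True
        then show ?thesis using uv by auto
      next
        case False
        have "\<not> W \<subseteq> {u, v}" using root_card[OF R] card_mono[of "{u, v}" W] card_insert_le_m1[of 2 "{v}" u]
          by fastforce
        then show ?thesis using False by blast
      qed
      then obtain z where z: "z \<in> W" "z \<noteq> u" "z \<noteq> v" "x \<in> W \<longrightarrow> z = x" by blast
      have "f c = f d" if "{c, d} \<in> F" "c \<noteq> z" "d \<noteq> z" for c d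
        using f that z(4) root_edge_pair[OF R that(1)] by blast
      then show ?thesis using root_connected[OF R z(1), of f u v] uv z by blast
    qed
    have st: "f (ys ! i) = f (ys ! Suc i)" if "i < l" "ys ! i \<noteq> x" "ys ! Suc i \<noteq> x" for i
      using f that peI[of i "Suc i"] by auto
    have pre: "i \<le> l \<Longrightarrow> \<forall>j\<le>i. ys ! j \<noteq> x \<Longrightarrow> f (ys ! i) = f (ys ! 0)" for i
      by (induction i) (use st in auto)
    have suf: "i \<le> l \<Longrightarrow> \<forall>j. l - i \<le> j \<longrightarrow> j \<le> l \<longrightarrow> ys ! j \<noteq> x \<Longrightarrow> f (ys ! (l - i)) = f (ys ! l)" for i
    proof (induction i)
      case (Suc i)
      then show ?case using st[of "l - Suc i"] by (auto simp: Suc_diff_Suc)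
    qed simp
    \<comment> \<open>An ear vertex is followed back to the start of the ear if \<open>x\<close> is
      not met there, and otherwise forward to its end.\<close>
    have toW: "\<exists>w\<in>W. w \<noteq> x \<and> f u = f w" if u: "u \<in> W \<union> set ys" "u \<noteq> x" for u
    proof (cases "u \<in> W")
      case True
      then show ?thesis using u by blast
    next
      case False
      then obtain i where i: "i \<le> l" "u = ys ! i" using u l by (auto simp: in_set_conv_nth less_Suc_eq_le)
      show ?thesis
      proof (cases "\<forall>j\<le>i. ys ! j \<noteq> x")
        case True
        then show ?thesis using pre[of i] i inW[of 0] by auto
      next
        case False
        then obtain k where "k \<le> i" "ys ! k = x" by blast
        then have "\<forall>j. i \<le> j \<longrightarrow> j \<le> l \<longrightarrow> ys ! j \<noteq> x"
          using inj i u by (metis le_antisym le_trans)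
        then show ?thesis using suf[of "l - i"] i inW[of l] by auto
      qed
    qed
    show ?thesis using toW[of a] toW[of b] old ab by metis
  qed
  have card: "card (W \<union> set ys) \<ge> 3"
    using root_card[OF R] card_mono[of "W \<union> set ys" W] root_finite[OF R] by auto
  have fin: "finite (W \<union> set ys)" using root_finite[OF R] by simp
  show ?thesis
    unfolding root_graph_def
  proof (intro conjI ballI allI impI)
    fix x a b and f :: "_ \<Rightarrow> bool"
    assume "\<forall>a b. {a, b} \<in> F \<union> path_edges ys \<longrightarrow> a \<noteq> x \<longrightarrow> b \<noteq> x \<longrightarrow> f a = f b"
      and "x \<in> W \<union> set ys" "a \<in> W \<union> set ys" "b \<in> W \<union> set ys" "a \<noteq> x" "b \<noteq> x"
    then show "f a = f b" by (rule conn)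
  next
    fix e assume "e \<in> F \<union> path_edges ys"
    then show "\<exists>a\<in>W \<union> set ys. \<exists>b\<in>W \<union> set ys. a \<noteq> b \<and> e = {a, b}" by (rule edges)
  next
    fix a b c assume "{a, b} \<in> F \<union> path_edges ys" "{b, c} \<in> F \<union> path_edges ys"
    then show "{a, c} \<notin> F \<union> path_edges ys" by (rule tri)
  next
    fix x assume "x \<in> W \<union> set ys"
    then show "\<exists>a b. a \<noteq> b \<and> {x, a} \<in> F \<union> path_edges ys \<and> {x, b} \<in> F \<union> path_edges ys"
      by (rule deg)
  qed (rule fin card)+
qed

subsection \<open>Gates as line graphs\<close>

definition line_graph :: "'a set \<Rightarrow> 'a set set \<Rightarrow> 'c set set \<Rightarrow> ('a \<Rightarrow> 'c set) \<Rightarrow> bool" where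
  "line_graph V E F n \<longleftrightarrow> bij_betw n V F \<and>
     E = {{u, v} | u v. u \<in> V \<and> v \<in> V \<and> u \<noteq> v \<and> n u \<inter> n v \<noteq> {}}"

lemma line_graph_adj:
  assumes "line_graph V E F n" "u \<in> V" "v \<in> V"
  shows "{u, v} \<in> E \<longleftrightarrow> u \<noteq> v \<and> n u \<inter> n v \<noteq> {}"
proof -
  have "{u, v} \<in> E \<longleftrightarrow> (\<exists>x y. {u, v} = {x, y} \<and> x \<in> V \<and> y \<in> V \<and> x \<noteq> y \<and> n x \<inter> n y \<noteq> {})"
    using assms(1) unfolding line_graph_def by auto
  also have "\<dots> \<longleftrightarrow> u \<noteq> v \<and> n u \<inter> n v \<noteq> {}"
    using assms(2,3) by (auto simp: doubleton_eq_iff)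
  finally show ?thesis .
qed

section \<open>Stars, cliques and connectedness of line graphs of root graphs\<close>

context
  fixes V :: "'a set" and E W F and n :: "'a \<Rightarrow> 'c set"
  assumes R: "root_graph W F" and L: "line_graph V E F n"
begin

lemma line_graph_in: "v \<in> V \<Longrightarrow> n v \<in> F"
  using L by (auto simp: line_graph_def bij_betw_def)

lemma line_graph_surj: "e \<in> F \<Longrightarrow> \<exists>v\<in>V. n v = e"
  using L by (auto simp: line_graph_def bij_betw_def)

lemma line_graph_ends: "v \<in> V \<Longrightarrow> \<exists>a\<in>W. \<exists>b\<in>W. a \<noteq> b \<and> n v = {a, b}"
  using root_edge[OF R line_graph_in] by blast

text \<open>Both root edges have exactly two ends, so they coincide, and \<open>n\<close> is
  injective. Hence distinct stars share at most one vertex.\<close>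

lemma line_graph_unique:
  assumes uv: "u \<in> V" "v \<in> V" and "{x, y} \<subseteq> n u" "{x, y} \<subseteq> n v" "x \<noteq> y"
  shows "u = v"
proof -
  have "n u = n v" using line_graph_ends[OF uv(1)] line_graph_ends[OF uv(2)] assms by auto
  then show ?thesis using L uv by (auto simp: line_graph_def bij_betw_def inj_on_def)
qed

text \<open>This is the minimum degree two of the root graph; \<open>v\<close> is an arbitrary
  element to be avoided.\<close>

lemma line_graph_star_two:
  assumes "x \<in> W"
  shows "\<exists>g\<in>V. g \<noteq> v \<and> x \<in> n g"
proof -
  obtain a b where ab: "a \<noteq> b" "{x, a} \<in> F" "{x, b} \<in> F" using root_degree[OF R assms] by blast
  obtain g h where gh: "g \<in> V" "n g = {x, a}" "h \<in> V" "n h = {x, b}" using line_graph_surj ab by metis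
  then have "g \<noteq> h" using ab by (auto simp: doubleton_eq_iff)
  then show ?thesis using gh by (metis insertI1)
qed

text \<open>Two vertices of the star of \<open>x\<close> that also lie in the star of another
  \<open>z\<close> would coincide. Stars are therefore pairwise incomparable, which gives both their
  maximality and their number.\<close>

lemma line_graph_star_subset:
  assumes "x \<in> W" "{v \<in> V. x \<in> n v} \<subseteq> {v \<in> V. z \<in> n v}"
  shows "x = z"
proof (rule ccontr)
  assume "x \<noteq> z"
  obtain g where g: "g \<in> V" "x \<in> n g" using line_graph_star_two[OF assms(1)] by blast
  obtain h where h: "h \<in> V" "h \<noteq> g" "x \<in> n h" using line_graph_star_two[OF assms(1)] by blast
  have "z \<in> n g" "z \<in> n h" using assms(2) g h by auto
  then show False using line_graph_unique[of g h x z] g h \<open>x \<noteq> z\<close> by simp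
qed

text \<open>Pairwise intersecting two-element sets either have a common element or form a triangle,
  and the root graph has no triangle.\<close>

lemma line_graph_complete:
  assumes "complete_set V E X"
  shows "\<exists>x\<in>W. X \<subseteq> {v \<in> V. x \<in> n v}"
proof (cases "X = {}")
  case True
  have "W \<noteq> {}" using root_card[OF R] by auto
  then show ?thesis using True by blast
next
  case False
  then obtain v where v: "v \<in> X" by blast
  have XV: "X \<subseteq> V" and adj: "\<And>u w. u \<in> X \<Longrightarrow> w \<in> X \<Longrightarrow> u \<noteq> w \<Longrightarrow> n u \<inter> n w \<noteq> {}"
    using assms line_graph_adj[OF L] unfolding complete_set_def by blast+
  have vV: "v \<in> V" using v XV by blast
  obtain a b where ab: "a \<in> W" "b \<in> W" "a \<noteq> b" "n v = {a, b}"
    using line_graph_ends[OF vV] by blast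
  have "(\<forall>g\<in>X. a \<in> n g) \<or> (\<forall>g\<in>X. b \<in> n g)"
  proof (rule ccontr)
    assume "\<not> ?thesis"
    then obtain g h where gh: "g \<in> X" "a \<notin> n g" "h \<in> X" "b \<notin> n h" by blast
    have gV: "g \<in> V" and hV: "h \<in> V" using gh XV by auto
    have "b \<in> n g" "a \<in> n h" using adj[of g v] adj[of h v] gh v ab by auto
    then obtain c d where c: "n g = {b, c}" and d: "n h = {a, d}"
      using line_graph_ends[OF gV] line_graph_ends[OF hV] by (metis insertE insert_commute singletonD)
    have "g \<noteq> h" using gh \<open>b \<in> n g\<close> by auto
    then have "n g \<inter> n h \<noteq> {}" using adj gh by blast
    then have "c = d" using c d gh ab by auto
    then have "{a, b} \<in> F" "{b, c} \<in> F" "{a, c} \<in> F"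
      using line_graph_in[OF vV] line_graph_in[OF gV] line_graph_in[OF hV] ab c d by auto
    then show False using root_triangle[OF R] by blast
  qed
  then show ?thesis using XV ab by blast
qed

lemma line_graph_star_complete: "complete_set V E {v \<in> V. x \<in> n v}"
  unfolding complete_set_def using line_graph_adj[OF L] by auto

text \<open>Stars are complete, every complete set lies in a star, and no star lies properly inside
  another.\<close>

lemma line_graph_clique_iff: "is_clique V E C \<longleftrightarrow> (\<exists>x\<in>W. C = {v \<in> V. x \<in> n v})"
proof
  assume C: "is_clique V E C"
  then obtain x where "x \<in> W" "C \<subseteq> {v \<in> V. x \<in> n v}"
    using line_graph_complete[of C] by (auto simp: is_clique_def)
  then show "\<exists>x\<in>W. C = {v \<in> V. x \<in> n v}"
    using C line_graph_star_complete[of x] unfolding is_clique_def by blast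
next
  assume "\<exists>x\<in>W. C = {v \<in> V. x \<in> n v}"
  then obtain x where x: "x \<in> W" "C = {v \<in> V. x \<in> n v}" by blast
  have "K = C" if K: "complete_set V E K" "C \<subseteq> K" for K
  proof -
    obtain z where z: "K \<subseteq> {v \<in> V. z \<in> n v}" using line_graph_complete[OF K(1)] by blast
    then have "x = z" using line_graph_star_subset[OF x(1)] K x by blast
    then show ?thesis using z K x by blast
  qed
  then show "is_clique V E C" using line_graph_star_complete[of x] x unfolding is_clique_def by blast
qed

lemma card_line_graph_cliques: "card {C. is_clique V E C} = card W"
proof -
  have "{C. is_clique V E C} = (\<lambda>x. {v \<in> V. x \<in> n v}) ` W"
    using line_graph_clique_iff by auto
  moreover have "inj_on (\<lambda>x. {v \<in> V. x \<in> n v}) W"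
    using line_graph_star_subset by (intro inj_onI) blast
  ultimately show ?thesis by (simp add: card_image)
qed

text \<open>The set \<open>X\<close> lies in the star of some \<open>x\<close>. A colouring of the
  vertices outside \<open>X\<close> is carried over to the root vertices, where deleting
  \<open>x\<close> leaves a connected graph.\<close>

lemma line_graph_connected:
  assumes X: "complete_set V E X"
    and s: "\<And>u v. u \<in> V - X \<Longrightarrow> v \<in> V - X \<Longrightarrow> {u, v} \<in> E \<Longrightarrow> s u = s v"
    and uv: "u \<in> V - X" "v \<in> V - X"
  shows "(s :: _ \<Rightarrow> bool) u = s v"
proof -
  obtain x where x: "x \<in> W" "X \<subseteq> {v \<in> V. x \<in> n v}" using line_graph_complete[OF X] by blast
  \<comment> \<open>The root edges at \<open>y\<close> outside \<open>X\<close> are pairwise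
    adjacent and so have one colour; away from empty stars, \<open>f y\<close> is that
    colour.\<close>
  define f where "f y = (\<exists>w\<in>V - X. y \<in> n w \<and> s w)" for y
  have common: "s w = s w'" if "w \<in> V - X" "w' \<in> V - X" "y \<in> n w" "y \<in> n w'" for w w' y
    using s[of w w'] line_graph_adj[OF L, of w w'] that by blast
  have f: "f y = s w" if "w \<in> V - X" "y \<in> n w" for w y
    using common that unfolding f_def by blast
  have fc: "f a = f b" if e: "{a, b} \<in> F" "a \<noteq> x" "b \<noteq> x" for a b
  proof -
    obtain w where w: "w \<in> V" "n w = {a, b}" using line_graph_surj[OF e(1)] by blast
    then have "w \<in> V - X" using x e by auto
    then show ?thesis using f w by auto
  qed
  \<comment> \<open>A vertex outside \<open>X\<close> may still have \<open>x\<close> as an end, so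
    colours are compared at an end different from \<open>x\<close>.\<close>
  have away: "\<exists>y\<in>W. y \<noteq> x \<and> y \<in> n w" if "w \<in> V" for w
    using line_graph_ends[OF that] by (metis insertI1 insertI2)
  obtain a b where ab: "a \<in> W" "a \<noteq> x" "a \<in> n u" "b \<in> W" "b \<noteq> x" "b \<in> n v"
    using away uv by blast
  have "f a = f b" by (rule root_connected[OF R x(1) fc]) (use ab in auto)
  then show ?thesis using f ab uv by blast
qed

end

section \<open>Root graphs for cycles and for the extension step of gates\<close>

lemma ex_fun_on_list:
  assumes "distinct xs"
  shows "\<exists>g. (\<forall>i<length xs. g (xs ! i) = h i) \<and> (\<forall>v. v \<notin> set xs \<longrightarrow> g v = g0 v)"
proof -
  have "(THE j. j < length xs \<and> xs ! j = xs ! i) = i" if "i < length xs" for i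
    using that assms by (intro the_equality) (auto simp: nth_eq_iff_index_eq)
  then show ?thesis
    by (intro exI[of _ "\<lambda>v. if v \<in> set xs then h (THE j. j < length xs \<and> xs ! j = v) else g0 v"]) auto
qed

text \<open>A cycle is its own line graph: the vertex at position \<open>i\<close> stands for the
  edge from \<open>i\<close> to its cyclic successor.\<close>

lemma cycle_line_graph:
  assumes "cycle_graph V E"
  shows "\<exists>(W :: nat set) F n. root_graph W F \<and> line_graph V E F n"
proof -
  obtain xs where xs: "distinct xs" "length xs \<ge> 4" "set xs = V"
    and E: "E = {{xs ! i, xs ! (Suc i mod length xs)} | i. i < length xs}"
    using assms unfolding cycle_graph_def by blast
  define m where "m = length xs"
  have m: "m \<ge> 4" using xs by (simp add: m_def)
  define F where "F = {{i, Suc i mod m} | i. i < m}"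
  obtain n where n: "\<And>i. i < m \<Longrightarrow> n (xs ! i) = {i, Suc i mod m}"
    using ex_fun_on_list[OF xs(1), of "\<lambda>i. {i, Suc i mod m}" "\<lambda>_. {}"] by (auto simp: m_def)
  have V: "V = (\<lambda>i. xs ! i) ` {..<m}" using xs by (auto simp: m_def set_conv_nth)
  have inj: "xs ! i = xs ! j \<longleftrightarrow> i = j" if "i < m" "j < m" for i j
    using that xs by (simp add: m_def nth_eq_iff_index_eq)
  have "inj_on n V"
  proof (rule inj_onI)
    fix u v assume uv: "u \<in> V" "v \<in> V" "n u = n v"
    then obtain i j where ij: "i < m" "j < m" "u = xs ! i" "v = xs ! j" using V by auto
    then have "{i, Suc i mod m} = {j, Suc j mod m}" using uv n by simp
    then have "i = j" using ij m by (auto simp: doubleton_eq_iff mod_Suc split: if_splits)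
    then show "u = v" using ij by simp
  qed
  moreover have "n ` V = F" unfolding V F_def using n by (auto simp: image_iff)
  ultimately have bij: "bij_betw n V F" by (simp add: bij_betw_def)
  have meet: "n (xs ! i) \<inter> n (xs ! j) \<noteq> {} \<longleftrightarrow> j = Suc i mod m \<or> i = Suc j mod m"
    if "i < m" "j < m" "i \<noteq> j" for i j
    using that m n by (auto simp: mod_Suc split: if_splits)
  have "E = {{u, v} | u v. u \<in> V \<and> v \<in> V \<and> u \<noteq> v \<and> n u \<inter> n v \<noteq> {}}" (is "_ = ?E")
  proof
    show "E \<subseteq> ?E"
    proof
      fix e assume "e \<in> E"
      then obtain i where i: "i < m" "e = {xs ! i, xs ! (Suc i mod m)}" unfolding E m_def by blast
      have j: "Suc i mod m < m" "i \<noteq> Suc i mod m" using m i by (auto simp: mod_Suc)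
      have "xs ! i \<in> V" "xs ! (Suc i mod m) \<in> V" "xs ! i \<noteq> xs ! (Suc i mod m)"
        using V inj i j by auto
      moreover have "n (xs ! i) \<inter> n (xs ! (Suc i mod m)) \<noteq> {}" using meet i j by blast
      ultimately show "e \<in> ?E" using i by blast
    qed
    show "?E \<subseteq> E"
    proof
      fix e assume "e \<in> ?E"
      then obtain u v where uv: "e = {u, v}" "u \<in> V" "v \<in> V" "u \<noteq> v" "n u \<inter> n v \<noteq> {}" by blast
      then obtain i j where ij: "i < m" "j < m" "u = xs ! i" "v = xs ! j" using V by auto
      then have "j = Suc i mod m \<or> i = Suc j mod m" using meet[of i j] uv by auto
      then show "e \<in> E" unfolding E m_def[symmetric] using ij uv by (auto simp: insert_commute)
    qed
  qed
  with bij have "line_graph V E F n" by (simp add: line_graph_def)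
  moreover have "root_graph {..<m} F" unfolding F_def by (rule root_graph_cycle[OF m])
  ultimately show ?thesis by blast
qed

text \<open>The cliques \<open>C\<close> and \<open>C'\<close> are the stars of root vertices
  \<open>p\<close> and \<open>r\<close>, which are distinct and non-adjacent because the stars are
  disjoint. The path \<open>ps\<close> becomes an ear from \<open>p\<close> to \<open>r\<close> with
  one edge for each entry of \<open>ps\<close>.\<close>

lemma ear_line_graph:
  fixes W :: "nat set"
  assumes R: "root_graph W F" and L: "line_graph V E F n"
    and C: "is_clique V E C" "is_clique V E C'" "C \<inter> C' = {}"
    and ps: "distinct ps" "length ps \<ge> 2" "set ps \<inter> V = {}"
  shows "\<exists>(W :: nat set) F n. root_graph W F \<and> line_graph (V \<union> set ps)
    (E \<union> path_edges ps \<union> {{hd ps, c} | c. c \<in> C} \<union> {{last ps, c} | c. c \<in> C'}) F n"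
proof -
  obtain p r where p: "p \<in> W" "C = {v \<in> V. p \<in> n v}" and r: "r \<in> W" "C' = {v \<in> V. r \<in> n v}"
    using line_graph_clique_iff[OF R L] C by auto
  have "p \<noteq> r" using line_graph_star_two[OF R L p(1)] C p r by auto
  have prF: "{p, r} \<notin> F"
  proof
    assume "{p, r} \<in> F"
    then obtain v where "v \<in> V" "n v = {p, r}" using line_graph_surj[OF R L] by blast
    then show False using C p r by auto
  qed
  define l where "l = length ps"
  have l: "l \<ge> 2" using ps by (simp add: l_def)
  \<comment> \<open>Numbers from \<open>M\<close> on are fresh and serve as inner ear
    vertices.\<close>
  obtain M where M: "\<And>w. w \<in> W \<Longrightarrow> w < M"
    using root_finite[OF R] finite_nat_set_iff_bounded[of W] by auto
  \<comment> \<open>There are \<open>l - 1\<close> inner vertices, so that the ear has exactly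
    \<open>l\<close> edges.\<close>
  define ys where "ys = p # [M..<M + (l - 1)] @ [r]"
  have ylen: "length ys = Suc l" using l by (simp add: ys_def)
  have yd: "distinct ys" using M[OF p(1)] M[OF r(1)] \<open>p \<noteq> r\<close> by (auto simp: ys_def)
  have ends: "hd ys = p" "last ys = r" by (auto simp: ys_def)
  have yW: "set ys \<inter> W = {hd ys, last ys}" using M p r by (force simp: ys_def)
  have y0: "ys ! 0 = p" and yl: "ys ! l = r" using ends ylen
    by (simp add: ys_def, metis last_conv_nth ylen diff_Suc_1 length_0_conv nat.simps(3))
  have inj: "ys ! i = ys ! j \<longleftrightarrow> i = j" if "i \<le> l" "j \<le> l" for i j
    using yd ylen that by (simp add: nth_eq_iff_index_eq)
  have inW: "ys ! i \<in> W \<longleftrightarrow> i = 0 \<or> i = l" if "i \<le> l" for i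
  proof -
    have "ys ! i \<in> set ys" using that ylen by auto
    then have "ys ! i \<in> W \<longleftrightarrow> ys ! i \<in> {ys ! 0, ys ! l}" using yW ends y0 yl by auto
    then show ?thesis using inj that by auto
  qed
  have R': "root_graph (W \<union> set ys) (F \<union> path_edges ys)"
    by (rule root_graph_ear[OF R yd _ yW]) (use l ylen ends prF in auto)
  obtain n' where np: "\<And>i. i < l \<Longrightarrow> n' (ps ! i) = {ys ! i, ys ! Suc i}"
    and nV': "\<And>v. v \<notin> set ps \<Longrightarrow> n' v = n v"
    using ex_fun_on_list[OF ps(1), of "\<lambda>i. {ys ! i, ys ! Suc i}" n] unfolding l_def by blast
  have nV: "n' v = n v" if "v \<in> V" for v using nV' ps that by blast
  have psV: "ps ! i \<notin> V" if "i < l" for i using ps(3) nth_mem[of i ps] that unfolding l_def by blast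
  have psinj: "ps ! i = ps ! j \<longleftrightarrow> i = j" if "i < l" "j < l" for i j
    using ps that by (simp add: l_def nth_eq_iff_index_eq)
  have setps: "set ps = (\<lambda>i. ps ! i) ` {..<l}" by (auto simp: l_def set_conv_nth)
  have nW: "n v \<subseteq> W" if "v \<in> V" for v using line_graph_ends[OF R L that] by auto
  have pp: "n' (ps ! i) \<inter> n' (ps ! j) \<noteq> {} \<longleftrightarrow> i = Suc j \<or> j = Suc i"
    if "i < l" "j < l" "i \<noteq> j" for i j
    using that inj[of i j] inj[of i "Suc j"] inj[of "Suc i" j] inj[of "Suc i" "Suc j"]
    by (auto simp: np)
  \<comment> \<open>Only the first and the last ear edge reach \<open>W\<close>, at \<open>p\<close>
    and at \<open>r\<close>; these give the edges joining \<open>ps\<close> to the two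
    cliques.\<close>
  have pv: "n' (ps ! i) \<inter> n v \<noteq> {} \<longleftrightarrow> (i = 0 \<and> p \<in> n v) \<or> (Suc i = l \<and> r \<in> n v)"
    if "i < l" "v \<in> V" for i v
    using that inW[of i] inW[of "Suc i"] nW[of v] y0 yl l by (auto simp: np)
  have "ps \<noteq> []" using ps(2) by auto
  then have hd: "hd ps = ps ! 0" and la: "last ps = ps ! (l - 1)"
    by (simp_all add: l_def hd_conv_nth last_conv_nth)
  have "inj_on n' (V \<union> set ps)"
  proof -
    have "inj_on n' V" using L nV by (auto simp: line_graph_def bij_betw_def inj_on_def)
    moreover have "inj_on n' (set ps)"
    proof (rule inj_onI)
      fix u v assume uv: "u \<in> set ps" "v \<in> set ps" "n' u = n' v"
      then obtain i j where ij: "i < l" "j < l" "u = ps ! i" "v = ps ! j" using setps by auto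
      then have "{ys ! i, ys ! Suc i} = {ys ! j, ys ! Suc j}" using uv np by simp
      then have "i = j" using ij inj[of i j] inj[of i "Suc j"] inj[of "Suc i" j]
        by (auto simp: doubleton_eq_iff)
      then show "u = v" using ij by simp
    qed
    \<comment> \<open>An ear edge with both ends in \<open>W\<close> would be the whole ear, but the
      ear has at least two edges.\<close>
    moreover have "n' u \<noteq> n' v" if uv: "u \<in> V" "v \<in> set ps" for u v
    proof
      assume eq: "n' u = n' v"
      obtain i where i: "i < l" "v = ps ! i" using uv setps by auto
      then have "ys ! i \<in> W" "ys ! Suc i \<in> W" using eq np nV[OF uv(1)] nW[OF uv(1)] by auto
      then have "i = 0" "Suc i = l" using inW i l by auto
      then show False using l by simp
    qed
    ultimately show ?thesis by (auto simp: inj_on_def) metis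
  qed
  moreover have "n' ` (V \<union> set ps) = F \<union> path_edges ys"
  proof -
    have "n' ` V = F" using L nV by (auto simp: line_graph_def bij_betw_def image_iff)
    moreover have "n' ` set ps = path_edges ys"
      unfolding setps path_edges_def ylen using np by (auto simp: image_iff)
    ultimately show ?thesis by auto
  qed
  ultimately have bij: "bij_betw n' (V \<union> set ps) (F \<union> path_edges ys)" by (simp add: bij_betw_def)
  let ?E = "E \<union> path_edges ps \<union> {{hd ps, c} | c. c \<in> C} \<union> {{last ps, c} | c. c \<in> C'}"
  let ?U = "V \<union> set ps"
  let ?A = "\<lambda>u v. u \<in> ?U \<and> v \<in> ?U \<and> u \<noteq> v \<and> n' u \<inter> n' v \<noteq> {}"
  have E: "E = {{u, v} | u v. u \<in> V \<and> v \<in> V \<and> u \<noteq> v \<and> n u \<inter> n v \<noteq> {}}"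
    using L by (simp add: line_graph_def)
  have new_edge: "{ps ! i, v} \<in> ?E" if A: "?A (ps ! i) v" and i: "i < l" for i v
  proof (cases "v \<in> V")
    case True
    then have "(i = 0 \<and> p \<in> n v) \<or> (Suc i = l \<and> r \<in> n v)" using pv i A nV by auto
    then show ?thesis
    proof
      assume "i = 0 \<and> p \<in> n v"
      then show ?thesis using hd True p(2) by auto
    next
      assume *: "Suc i = l \<and> r \<in> n v"
      then have "i = l - 1" by auto
      then show ?thesis using * la True r(2) by auto
    qed
  next
    case False
    then obtain j where j: "j < l" "v = ps ! j" using A setps by auto
    have "i = Suc j \<or> j = Suc i" using pp[OF i j(1)] A j by auto
    then have "{ps ! i, ps ! j} \<in> path_edges ps"
      using path_edgesI[of i ps] path_edgesI[of j ps] i j by (auto simp: l_def insert_commute)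
    then show ?thesis using j by blast
  qed
  have "?E = {{u, v} | u v. ?A u v}"
  proof
    have 1: "E \<subseteq> {{u, v} | u v. ?A u v}"
    proof
      fix e assume "e \<in> E"
      then obtain u v where "e = {u, v}" "u \<in> V" "v \<in> V" "u \<noteq> v" "n u \<inter> n v \<noteq> {}"
        using E by blast
      then have "e = {u, v} \<and> ?A u v" using nV by simp
      then show "e \<in> {{u, v} | u v. ?A u v}" by blast
    qed
    have 2: "path_edges ps \<subseteq> {{u, v} | u v. ?A u v}"
    proof
      fix e assume "e \<in> path_edges ps"
      then obtain i where i: "Suc i < l" "e = {ps ! i, ps ! Suc i}" unfolding path_edges_def l_def by blast
      have "?A (ps ! i) (ps ! Suc i)"
        using i pp[of i "Suc i"] psinj[of i "Suc i"] by (auto simp: l_def)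
      then show "e \<in> {{u, v} | u v. ?A u v}" using i by blast
    qed
    have 3: "{{hd ps, c} | c. c \<in> C} \<subseteq> {{u, v} | u v. ?A u v}"
    proof
      fix e assume "e \<in> {{hd ps, c} | c. c \<in> C}"
      then obtain c where c: "e = {ps ! 0, c}" "c \<in> V" "p \<in> n c" using hd p(2) by auto
      have "ps ! 0 \<in> set ps" "ps ! 0 \<notin> V" using l setps psV[of "0"] by auto
      moreover have "n' (ps ! 0) \<inter> n' c \<noteq> {}" using pv[of "0" c] c nV l by simp
      ultimately have "?A (ps ! 0) c" using c by blast
      then show "e \<in> {{u, v} | u v. ?A u v}" using c by blast
    qed
    have 4: "{{last ps, c} | c. c \<in> C'} \<subseteq> {{u, v} | u v. ?A u v}"
    proof
      fix e assume "e \<in> {{last ps, c} | c. c \<in> C'}"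
      then obtain c where c: "e = {ps ! (l - 1), c}" "c \<in> V" "r \<in> n c" using la r(2) by auto
      have "ps ! (l - 1) \<in> set ps" "ps ! (l - 1) \<notin> V" using l setps psV[of "l - 1"] by auto
      moreover have "n' (ps ! (l - 1)) \<inter> n' c \<noteq> {}" using pv[of "l - 1" c] c nV l by simp
      ultimately have "?A (ps ! (l - 1)) c" using c by blast
      then show "e \<in> {{u, v} | u v. ?A u v}" using c by blast
    qed
    show "?E \<subseteq> {{u, v} | u v. ?A u v}" using 1 2 3 4 by (intro Un_least)
    show "{{u, v} | u v. ?A u v} \<subseteq> ?E"
    proof
      fix e assume "e \<in> {{u, v} | u v. ?A u v}"
      then obtain u v where uv: "e = {u, v}" "?A u v" by blast
      show "e \<in> ?E"
      proof (cases "u \<in> V \<and> v \<in> V")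
        case True
        then have "e \<in> E" using uv nV line_graph_adj[OF L, of u v] by simp
        then show ?thesis by blast
      next
        case False
        then consider i where "i < l" "u = ps ! i" | i where "i < l" "v = ps ! i"
          using uv setps by auto
        then show ?thesis
        proof cases
          case 1
          then show ?thesis using new_edge[of i v] uv by simp
        next
          case 2
          have "?A v u" using uv(2) by (metis Int_commute)
          then show ?thesis using new_edge[of i u] uv 2 by (simp add: insert_commute)
        qed
      qed
    qed
  qed
  with bij have "line_graph ?U ?E (F \<union> path_edges ys) n'" unfolding line_graph_def by blast
  with R' show ?thesis by blast
qed

text \<open>Fixing \<open>nat\<close> as the type of root vertices keeps it constant through the
  induction while always leaving room for a new ear.\<close>

lemma gate_line_graph:
  assumes "gate V E"
  shows "\<exists>(W :: nat set) F n. root_graph W F \<and> line_graph V E F n"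
  using assms
proof (induction rule: gate.induct)
  case (cyc V E)
  then show ?case by (rule cycle_line_graph)
next
  case (ext V E C C' ps)
  then obtain W :: "nat set" and F n where "root_graph W F" "line_graph V E F n" by blast
  then show ?case by (rule ear_line_graph) (use ext in auto)
qed

subsection \<open>The center of the multipie\<close>

definition paths_through :: "'a set \<Rightarrow> ('a \<Rightarrow> 'b list) \<Rightarrow> 'b set \<Rightarrow> 'a set" where
  "paths_through S P t = {v \<in> S. t \<in> path_edges (P v)}"

text \<open>By the degree bound, the three pairs of spokes lie on three different paths. Hence any
  two of the paths share a spoke, and an edge at \<open>c\<close> common to all three would have to
  belong to all three pairs.\<close>

lemma form_claw_center:
  assumes "form_claw ET X Y Z" "distinct X" "distinct Y" "distinct Z"
  obtains c where
    "\<And>A B. A \<in> {X, Y, Z} \<Longrightarrow> B \<in> {X, Y, Z} \<Longrightarrow> path_edges A \<inter> path_edges B \<noteq> {}"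
    "c \<in> set X" "c \<in> set Y" "c \<in> set Z"
    "\<And>a. {c, a} \<in> path_edges X \<Longrightarrow> {c, a} \<in> path_edges Y \<Longrightarrow> {c, a} \<in> path_edges Z \<Longrightarrow> False"
proof -
  obtain c a b d where d: "distinct [c, a, b, d]"
    and all: "\<forall>s\<in>{{c, a}, {c, b}, {c, d}}. \<forall>t\<in>{{c, a}, {c, b}, {c, d}}. s \<noteq> t \<longrightarrow>
          (\<exists>U\<in>{X, Y, Z}. s \<in> path_edges U \<and> t \<in> path_edges U)"
    using assms(1) unfolding form_claw_def by blast
  have pair: "\<exists>U\<in>{X, Y, Z}. {c, x} \<in> path_edges U \<and> {c, y} \<in> path_edges U"
    if "x \<in> {a, b, d}" "y \<in> {a, b, d}" "x \<noteq> y" for x y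
  proof -
    have "{c, x} \<noteq> {c, y}" using that d by (auto simp: doubleton_eq_iff)
    moreover have "{c, x} \<in> {{c, a}, {c, b}, {c, d}}" "{c, y} \<in> {{c, a}, {c, b}, {c, d}}"
      using that by auto
    ultimately show ?thesis using all by (metis (no_types))
  qed
  have ne: "a \<noteq> b" "a \<noteq> d" "b \<noteq> d" using d by auto
  obtain U1 where U1: "U1 \<in> {X, Y, Z}" "{c, a} \<in> path_edges U1" "{c, b} \<in> path_edges U1"
    using pair[OF _ _ ne(1)] by blast
  obtain U2 where U2: "U2 \<in> {X, Y, Z}" "{c, a} \<in> path_edges U2" "{c, d} \<in> path_edges U2"
    using pair[OF _ _ ne(2)] by blast
  obtain U3 where U3: "U3 \<in> {X, Y, Z}" "{c, b} \<in> path_edges U3" "{c, d} \<in> path_edges U3"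
    using pair[OF _ _ ne(3)] by blast
  have dist: "distinct U" if "U \<in> {X, Y, Z}" for U using that assms by auto
  have deg: "x \<in> {y, z}" if "U \<in> {X, Y, Z}" "{c, x} \<in> path_edges U" "{c, y} \<in> path_edges U"
    "{c, z} \<in> path_edges U" "y \<noteq> z" for U x y z
    using path_degree_le_2[OF dist[OF that(1)] that(2-4)] that(5) by auto
  have "U1 \<noteq> U2" using deg[OF U1(1) _ U1(2,3) ne(1), of d] U2(3) ne by auto
  moreover have "U1 \<noteq> U3" using deg[OF U1(1) _ U1(2,3) ne(1), of d] U3(3) ne by auto
  moreover have "U2 \<noteq> U3" using deg[OF U2(1) _ U2(2,3) ne(2), of b] U3(2) ne by auto
  \<comment> \<open>The three witnesses are distinct, so they are the given paths in some order, and
    no case distinction on that order is needed.\<close>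
  ultimately have XYZ: "{X, Y, Z} = {U1, U2, U3}" using U1(1) U2(1) U3(1) by auto
  have no: "False" if e: "{c, e} \<in> path_edges X" "{c, e} \<in> path_edges Y" "{c, e} \<in> path_edges Z" for e
  proof -
    have "\<forall>U\<in>{X, Y, Z}. {c, e} \<in> path_edges U" using e by simp
    then have "{c, e} \<in> path_edges U1" "{c, e} \<in> path_edges U2" "{c, e} \<in> path_edges U3"
      unfolding XYZ by auto
    then have "e \<in> {a, b}" "e \<in> {a, d}" "e \<in> {b, d}"
      using deg[OF U1(1) _ U1(2,3) ne(1)] deg[OF U2(1) _ U2(2,3) ne(2)] deg[OF U3(1) _ U3(2,3) ne(3)]
      by auto
    then show False using ne by auto
  qed
  have mem: "\<forall>U\<in>{X, Y, Z}. c \<in> set U"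
    unfolding XYZ using U1(2) U2(2) U3(2) path_edges_subset by blast
  have meet: "path_edges A \<inter> path_edges B \<noteq> {}" if "A \<in> {X, Y, Z}" "B \<in> {X, Y, Z}" for A B
    using that U1(2,3) U2(2,3) U3(2,3) unfolding XYZ by auto
  show thesis by (rule that[of c, OF meet _ _ _ no]) (use mem in auto)
qed

section \<open>Orienting the tree edges by the paths of the gate\<close>

context
  fixes W :: "nat set" and F n and S :: "'a set" and E :: "'a set set"
    and VT :: "'b set" and ET :: "'b set set" and P :: "'a \<Rightarrow> 'b list"
  assumes R: "root_graph W F" and L: "line_graph S E F n"
    and T: "is_tree VT ET" and paths: "\<And>v. v \<in> S \<Longrightarrow> is_path VT ET (P v)"
    and adj: "\<And>u v. u \<in> S \<Longrightarrow> v \<in> S \<Longrightarrow> u \<noteq> v \<Longrightarrow>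
      {u, v} \<in> E \<longleftrightarrow> path_edges (P u) \<inter> path_edges (P v) \<noteq> {}"
begin

lemma paths_through_complete: "complete_set S E (paths_through S P t)"
  unfolding complete_set_def paths_through_def using adj by auto

lemma paths_through_subset_star: "\<exists>x\<in>W. paths_through S P t \<subseteq> {v \<in> S. x \<in> n v}"
  using line_graph_complete[OF R L paths_through_complete] .

lemma path_vertices: "v \<in> S \<Longrightarrow> P v \<noteq> [] \<and> distinct (P v) \<and> set (P v) \<subseteq> VT"
  using paths by (auto simp: is_path_def)

text \<open>The paths through \<open>t\<close> lie in the star of some \<open>x\<close>. Going from
  \<open>x\<close> along a root edge to \<open>y\<close> and taking another edge at \<open>y\<close>
  leaves that star. Such a path makes the orientation below asymmetric.\<close>

lemma ex_path_avoiding: "\<exists>v\<in>S. t \<notin> path_edges (P v)"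
proof -
  obtain x where x: "x \<in> W" "paths_through S P t \<subseteq> {v \<in> S. x \<in> n v}"
    using paths_through_subset_star by blast
  obtain v where v: "v \<in> S" "x \<in> n v" using line_graph_star_two[OF R L x(1)] by blast
  obtain y where y: "y \<in> W" "y \<noteq> x" "y \<in> n v"
    using line_graph_ends[OF R L v(1)] by (metis insertI1 insertI2)
  obtain w where w: "w \<in> S" "w \<noteq> v" "y \<in> n w" using line_graph_star_two[OF R L y(1)] by blast
  have "x \<notin> n w"
    using line_graph_unique[OF R L w(1) v(1), of x y] w v y by auto
  then have "w \<notin> paths_through S P t" using x by auto
  then show ?thesis using w by (auto simp: paths_through_def)
qed

text \<open>Orients the tree edge from \<open>a\<close> to \<open>b\<close>: every path not using it lies on the side of \<open>b\<close>.\<close>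

definition avoiding_beyond :: "'b \<Rightarrow> 'b \<Rightarrow> bool" where
  "avoiding_beyond a b \<longleftrightarrow> (\<forall>v\<in>S. {a, b} \<notin> path_edges (P v) \<longrightarrow>
     (\<forall>z\<in>set (P v). (b, z) \<in> reach (ET - {{a, b}})))"

text \<open>Each path that avoids the edge lies on one side of it, and adjacent such paths share a
  vertex and hence the side. By \<open>line_graph_connected\<close> the side is the same for all of
  them.\<close>

lemma avoiding_beyond_total:
  assumes ab: "{a, b} \<in> ET"
  shows "avoiding_beyond a b \<or> avoiding_beyond b a"
proof -
  let ?r = "reach (ET - {{a, b}})"
  \<comment> \<open>The first vertex represents the whole path, since an avoiding path does not
    change sides.\<close>
  define s where "s v \<longleftrightarrow> (a, hd (P v)) \<in> ?r" for v
  have s: "(a, z) \<in> ?r \<longleftrightarrow> s v" if "v \<in> S" "{a, b} \<notin> path_edges (P v)" "z \<in> set (P v)" for v z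
  proof -
    have "hd (P v) \<in> set (P v)" using path_vertices that by simp
    then have h: "(hd (P v), z) \<in> ?r" by (rule path_same_side[OF paths[OF that(1)] that(2) _ that(3)])
    show ?thesis unfolding s_def using reach_trans h reach_sym[OF h] by metis
  qed
  have const: "s u = s v" if "u \<in> S - paths_through S P {a, b}" "v \<in> S - paths_through S P {a, b}" for u v
  proof (rule line_graph_connected[OF R L paths_through_complete _ that])
    fix u v
    assume uv: "u \<in> S - paths_through S P {a, b}" "v \<in> S - paths_through S P {a, b}" "{u, v} \<in> E"
    have "u \<noteq> v" using line_graph_adj[OF L] uv by blast
    then obtain e where "e \<in> path_edges (P u)" "e \<in> path_edges (P v)" using adj[of u v] uv by auto
    moreover then obtain z where "z \<in> e" by (auto simp: path_edges_def)
    ultimately have "z \<in> set (P u)" "z \<in> set (P v)" using path_edges_subset by blast+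
    then show "s u = s v" using s[of u z] s[of v z] uv by (auto simp: paths_through_def)
  qed
  show ?thesis
  proof (cases "\<exists>u\<in>S - paths_through S P {a, b}. s u")
    case True
    then obtain u where u: "u \<in> S - paths_through S P {a, b}" "s u" by blast
    have "(a, z) \<in> ?r" if v: "v \<in> S" "{a, b} \<notin> path_edges (P v)" "z \<in> set (P v)" for v z
    proof -
      have "v \<in> S - paths_through S P {a, b}" using v by (simp add: paths_through_def)
      then have "s v" using const[OF u(1)] u(2) by metis
      then show ?thesis using s v by blast
    qed
    then have "avoiding_beyond b a"
      unfolding avoiding_beyond_def insert_commute[of b a] by blast
    then show ?thesis ..
  next
    case False
    have "(b, z) \<in> ?r" if v: "v \<in> S" "{a, b} \<notin> path_edges (P v)" "z \<in> set (P v)" for v z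
    proof -
      have "\<not> s v" using False v by (auto simp: paths_through_def)
      then have "(a, z) \<notin> ?r" using s v by blast
      moreover have "z \<in> VT" using path_vertices v by auto
      ultimately show ?thesis using tree_edge_sides[OF T ab] by blast
    qed
    then have "avoiding_beyond a b" unfolding avoiding_beyond_def by blast
    then show ?thesis ..
  qed
qed

lemma avoiding_beyond_asym:
  assumes ab: "{a, b} \<in> ET" and D: "avoiding_beyond a b"
  shows "\<not> avoiding_beyond b a"
proof
  assume D': "avoiding_beyond b a"
  obtain v where v: "v \<in> S" "{a, b} \<notin> path_edges (P v)" using ex_path_avoiding by blast
  then obtain z where z: "z \<in> set (P v)" using path_vertices by (meson hd_in_set)
  have "(b, z) \<in> reach (ET - {{a, b}})" using D v z unfolding avoiding_beyond_def by blast
  moreover have "(a, z) \<in> reach (ET - {{a, b}})"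
    using D' v z unfolding avoiding_beyond_def insert_commute[of b a] by blast
  ultimately show False using tree_edge_cut[OF T ab] reach_sym reach_trans by metis
qed

text \<open>Take a sink \<open>q\<close>. A path missing \<open>q\<close> avoids the first edge from
  \<open>q\<close> towards it, so the orientation places the path on the side of \<open>q\<close>,
  although it contains a vertex on the other side.\<close>

lemma ex_pie_center:
  "\<exists>q\<in>VT. \<forall>v\<in>S. q \<in> set (P v)"
proof -
  obtain q where q: "q \<in> VT" "\<And>a. {q, a} \<in> ET \<Longrightarrow> avoiding_beyond a q"
    using tree_orientation_sink[OF T, of avoiding_beyond] avoiding_beyond_total avoiding_beyond_asym
    by blast
  have "q \<in> set (P v)" if v: "v \<in> S" for v
  proof (rule ccontr)
    assume nq: "q \<notin> set (P v)"
    obtain z where z: "z \<in> set (P v)" using path_vertices v by (meson hd_in_set)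
    then have "z \<in> VT" "q \<noteq> z" using path_vertices[OF v] nq by auto
    then obtain a where a: "{q, a} \<in> ET" "(a, z) \<in> reach (ET - {{q, a}})"
      using tree_first_edge[OF T q(1)] by blast
    have "{a, q} \<notin> path_edges (P v)" using nq path_edges_subset by fastforce
    then have "(q, z) \<in> reach (ET - {{q, a}})"
      using q(2)[OF a(1)] v z unfolding avoiding_beyond_def insert_commute[of a q] by blast
    then show False using a tree_edge_cut[OF T a(1)] reach_sym reach_trans by metis
  qed
  with q show ?thesis by blast
qed

section \<open>Spokes at a vertex common to all paths\<close>

context
  fixes q
  assumes qT: "q \<in> VT" and q: "\<And>v. v \<in> S \<Longrightarrow> q \<in> set (P v)"
begin

text \<open>A shared edge has an end \<open>z\<close> other than \<open>q\<close>. Both paths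
  contain \<open>q\<close> and \<open>z\<close>, hence also the first edge from \<open>q\<close>
  towards \<open>z\<close>.\<close>

lemma common_edge_at_center:
  assumes "u \<in> S" "v \<in> S" "u \<noteq> v" "{u, v} \<in> E"
  shows "\<exists>a. {q, a} \<in> path_edges (P u) \<and> {q, a} \<in> path_edges (P v)"
proof -
  obtain e where e: "e \<in> path_edges (P u)" "e \<in> path_edges (P v)" using adj assms by blast
  then have "e \<in> ET" using paths[OF assms(1)] by (auto simp: is_path_def)
  then obtain x y where xy: "e = {x, y}" "x \<noteq> y" using T unfolding is_tree_def simple_graph_def by blast
  then obtain z where z: "z \<in> e" "q \<noteq> z" by blast
  have zu: "z \<in> set (P u)" and zv: "z \<in> set (P v)" using z e path_edges_subset by blast+
  then have "z \<in> VT" using path_vertices assms(1) by blast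
  then show ?thesis
    using tree_common_first_edge[OF T qT _ z(2)] q zu zv paths assms by blast
qed

lemma adj_iff_common_edge_at_center:
  assumes "u \<in> S" "v \<in> S" "u \<noteq> v"
  shows "n u \<inter> n v \<noteq> {} \<longleftrightarrow> (\<exists>a. {q, a} \<in> path_edges (P u) \<and> {q, a} \<in> path_edges (P v))"
  using common_edge_at_center[OF assms] adj[OF assms] line_graph_adj[OF L assms(1,2)] assms(3) by blast

text \<open>Let \<open>v = xy\<close>. An edge \<open>f\<close> at the other end \<open>y\<close> takes up one of the two tree edges at \<open>q\<close> on the path of
  \<open>v\<close>; as no edge at \<open>x\<close> other than \<open>v\<close> meets \<open>f\<close>, all edges at \<open>x\<close> must share the remaining one.\<close>

lemma star_is_spoke:
  assumes x: "x \<in> W"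
  shows "\<exists>a. paths_through S P {q, a} = {v \<in> S. x \<in> n v}"
proof -
  obtain v where v: "v \<in> S" "x \<in> n v" using line_graph_star_two[OF R L x] by blast
  obtain y where y: "y \<in> W" "y \<noteq> x" "n v = {x, y}"
    using line_graph_ends[OF R L v(1)] v(2) by (metis insertE insert_commute singletonD)
  obtain f where f: "f \<in> S" "f \<noteq> v" "y \<in> n f" using line_graph_star_two[OF R L y(1)] by blast
  \<comment> \<open>If they met, the root edges of \<open>v\<close>, \<open>f\<close> and
    \<open>g\<close> would form a triangle.\<close>
  have fnot: "n f \<inter> n g = {}" if g: "g \<in> S" "g \<noteq> v" "x \<in> n g" for g
  proof (rule ccontr)
    assume "n f \<inter> n g \<noteq> {}"
    moreover obtain c where c: "n f = {y, c}"
      using line_graph_ends[OF R L f(1)] f(3) by (metis insertE insert_commute singletonD)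
    moreover obtain d where d: "n g = {x, d}"
      using line_graph_ends[OF R L g(1)] g(3) by (metis insertE insert_commute singletonD)
    moreover have "x \<notin> n f" "y \<notin> n g"
      using line_graph_unique[OF R L f(1) v(1), of x y] line_graph_unique[OF R L g(1) v(1), of x y] f g y
      by auto
    ultimately have "c = d" by auto
    then have "{x, y} \<in> F" "{y, c} \<in> F" "{x, c} \<in> F"
      using line_graph_in[OF R L v(1)] line_graph_in[OF R L f(1)] line_graph_in[OF R L g(1)] y c d by auto
    then show False using root_triangle[OF R] by blast
  qed
  obtain g where g: "g \<in> S" "g \<noteq> v" "x \<in> n g" using line_graph_star_two[OF R L x] by blast
  have gf: "g \<noteq> f" using fnot[OF g] g(3) by auto
  obtain a where a: "{q, a} \<in> path_edges (P v)" "{q, a} \<in> path_edges (P g)"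
    using adj_iff_common_edge_at_center[OF v(1) g(1)] g v by auto
  obtain b where b: "{q, b} \<in> path_edges (P v)" "{q, b} \<in> path_edges (P f)"
    using adj_iff_common_edge_at_center[OF v(1) f(1)] f y by auto
  have "{q, a} \<notin> path_edges (P f)"
    using adj_iff_common_edge_at_center[OF f(1) g(1)] fnot[OF g] gf a by auto
  then have "a \<noteq> b" using b by auto
  have "w \<in> paths_through S P {q, a}" if w: "w \<in> S" "x \<in> n w" for w
  proof (cases "w = v")
    case True
    then show ?thesis using v a by (simp add: paths_through_def)
  next
    case False
    obtain c where c: "{q, c} \<in> path_edges (P v)" "{q, c} \<in> path_edges (P w)"
      using adj_iff_common_edge_at_center[OF v(1) w(1)] False w v by auto
    have "w \<noteq> f" using fnot[OF w(1) False w(2)] w(2) by auto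
    then have "c \<noteq> b"
      using adj_iff_common_edge_at_center[OF f(1) w(1)] fnot[OF w(1) False w(2)] b c by auto
    then have "c = a"
      using path_degree_le_2[of "P v" q a b c] path_vertices[OF v(1)] a b c \<open>a \<noteq> b\<close> by auto
    then show ?thesis using c w by (simp add: paths_through_def)
  qed
  then have sub: "{v \<in> S. x \<in> n v} \<subseteq> paths_through S P {q, a}" by blast
  \<comment> \<open>For the reverse inclusion, the paths through this edge lie in some star. That
    star contains the star of \<open>x\<close>, so it equals it.\<close>
  obtain z where z: "paths_through S P {q, a} \<subseteq> {v \<in> S. z \<in> n v}"
    using paths_through_subset_star by blast
  have "x = z" by (rule line_graph_star_subset[OF R L x]) (use sub z in blast)
  then show ?thesis using sub z by blast
qed

text \<open>The spokes correspond to the root vertices, and \<open>P v\<close> contains exactly the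
  two spokes given by the ends of \<open>n v\<close>. The counting conditions then express that root
  edges have two ends and are determined by them, and that root degrees are at least two.\<close>

lemma ex_multipie:
  "\<exists>Q. card Q = card W \<and> multipie VT ET P S q Q"
proof -
  obtain \<alpha> where \<alpha>: "\<And>x. x \<in> W \<Longrightarrow> paths_through S P {q, \<alpha> x} = {v \<in> S. x \<in> n v}"
    using star_is_spoke by metis
  have inj: "inj_on \<alpha> W"
  proof (rule inj_onI)
    fix x y assume xy: "x \<in> W" "y \<in> W" "\<alpha> x = \<alpha> y"
    have "{v \<in> S. x \<in> n v} = {v \<in> S. y \<in> n v}"
      using \<alpha>[OF xy(1)] \<alpha>[OF xy(2)] xy(3) by simp
    then show "x = y" by (intro line_graph_star_subset[OF R L xy(1)]) simp
  qed
  have spoke: "{q, \<alpha> x} \<in> ET" if x: "x \<in> W" for x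
  proof -
    obtain v where "v \<in> S" "x \<in> n v" using line_graph_star_two[OF R L x] by blast
    then have "v \<in> paths_through S P {q, \<alpha> x}" using \<alpha> x by simp
    then show ?thesis using paths by (auto simp: paths_through_def is_path_def)
  qed
  have mem: "\<alpha> x \<in> set (P v) \<longleftrightarrow> x \<in> n v" if "x \<in> W" "v \<in> S" for x v
  proof -
    have "\<alpha> x \<in> set (P v) \<longleftrightarrow> {q, \<alpha> x} \<in> path_edges (P v)"
      using tree_path_edge[OF T paths[OF that(2)] spoke[OF that(1)] q[OF that(2)]]
        path_edges_subset[of "{q, \<alpha> x}" "P v"] by auto
    also have "\<dots> \<longleftrightarrow> v \<in> paths_through S P {q, \<alpha> x}" using that by (simp add: paths_through_def)
    finally show ?thesis using \<alpha> that by simp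
  qed
  have nW: "n v \<subseteq> W" "card (n v) = 2" if "v \<in> S" for v
    using line_graph_ends[OF R L that] by auto
  let ?Q = "\<alpha> ` W"
  have two: "card (set (P v) \<inter> ?Q) = 2" if v: "v \<in> S" for v
  proof -
    have "set (P v) \<inter> ?Q = \<alpha> ` n v" using mem[OF _ v] nW(1)[OF v] by auto
    then show ?thesis using nW[OF v] inj by (metis card_image inj_on_subset)
  qed
  have finS: "finite S"
  proof -
    have "finite F" using root_finite[OF R] root_edge[OF R]
      by (intro finite_subset[of F "Pow W"]) auto
    then show ?thesis using L by (auto simp: line_graph_def dest: bij_betw_finite)
  qed
  have one: "card {v \<in> S. {a, b} \<subseteq> set (P v)} \<le> 1" if ab: "a \<in> ?Q" "b \<in> ?Q" "a \<noteq> b" for a b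
  proof -
    obtain x y where xy: "x \<in> W" "y \<in> W" "a = \<alpha> x" "b = \<alpha> y" "x \<noteq> y" using ab by blast
    have "u = v" if "u \<in> S" "v \<in> S" "{a, b} \<subseteq> set (P u)" "{a, b} \<subseteq> set (P v)" for u v
      using line_graph_unique[OF R L that(1,2), of x y] mem[OF xy(1)] mem[OF xy(2)] xy that by simp
    then show ?thesis using finS by (simp add: card_le_Suc0_iff_eq)
  qed
  have deg: "card {v \<in> S. {q, a} \<subseteq> set (P v)} \<ge> 2" if a: "a \<in> ?Q" for a
  proof -
    obtain x where x: "x \<in> W" "a = \<alpha> x" using a by blast
    obtain g where g: "g \<in> S" "x \<in> n g" using line_graph_star_two[OF R L x(1)] by blast
    obtain h where h: "h \<in> S" "h \<noteq> g" "x \<in> n h" using line_graph_star_two[OF R L x(1)] by blast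
    have "{g, h} \<subseteq> {v \<in> S. {q, a} \<subseteq> set (P v)}" using g h x q mem by auto
    then have "card {g, h} \<le> card {v \<in> S. {q, a} \<subseteq> set (P v)}" using finS by (intro card_mono) auto
    then show ?thesis using h by simp
  qed
  have claw: "\<not> form_claw ET (P u) (P v) (P w)" if uvw: "u \<in> S" "v \<in> S" "w \<in> S" for u v w
  proof
    assume claw: "form_claw ET (P u) (P v) (P w)"
    have dist: "distinct (P u)" "distinct (P v)" "distinct (P w)" using path_vertices uvw by auto
    obtain c where
      meet: "\<And>A B. A \<in> {P u, P v, P w} \<Longrightarrow> B \<in> {P u, P v, P w} \<Longrightarrow> path_edges A \<inter> path_edges B \<noteq> {}"
      and c: "c \<in> set (P u)" "c \<in> set (P v)" "c \<in> set (P w)"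
      and no: "\<And>a. {c, a} \<in> path_edges (P u) \<Longrightarrow> {c, a} \<in> path_edges (P v) \<Longrightarrow>
        {c, a} \<in> path_edges (P w) \<Longrightarrow> False"
      using form_claw_center[OF claw dist] by metis
    show False
    proof (cases "c = q")
      case True
      \<comment> \<open>For a claw centred at \<open>q\<close>, the three paths are pairwise
        adjacent, so they lie in one star and share its spoke. No edge at the centre of a claw is
        common to its three paths.\<close>
      have "complete_set S E {u, v, w}"
        unfolding complete_set_def
      proof (intro conjI ballI impI)
        fix a b assume ab: "a \<in> {u, v, w}" "b \<in> {u, v, w}" "a \<noteq> b"
        have "path_edges (P a) \<inter> path_edges (P b) \<noteq> {}" by (rule meet) (use ab in auto)
        then show "{a, b} \<in> E" using adj ab uvw by blast
      qed (use uvw in simp)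
      then obtain x where "x \<in> W" "{u, v, w} \<subseteq> {v \<in> S. x \<in> n v}"
        using line_graph_complete[OF R L] by blast
      then have "{u, v, w} \<subseteq> paths_through S P {q, \<alpha> x}" using \<alpha> by simp
      then show False using no[of "\<alpha> x"] True by (simp add: paths_through_def)
    next
      case False
      have "c \<in> VT" using c path_vertices uvw by blast
      \<comment> \<open>For a claw centred elsewhere, all three paths also contain \<open>q\<close>
        and so share the first edge from \<open>c\<close> towards \<open>q\<close>.\<close>
      then obtain a where "\<forall>xs. is_path VT ET xs \<longrightarrow> c \<in> set xs \<longrightarrow> q \<in> set xs \<longrightarrow> {c, a} \<in> path_edges xs"
        using tree_common_first_edge[OF T _ qT False] by blast
      then show False using no[of a] c q uvw paths by blast
    qed
  qed
  have "multipie VT ET P S q ?Q"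
    unfolding multipie_def using qT root_finite[OF R] spoke two one deg claw by auto
  then show ?thesis using card_image[OF inj] by blast
qed

end

end

theorem theorem8:
  fixes V :: "'a set" and E :: "'a set set" and VT :: "'b set" and ET :: "'b set set"
    and P :: "'a \<Rightarrow> 'b list" and S :: "'a set" and k :: nat
  assumes "simple_graph V E"
    and "EPT_rep V E VT ET P"
    and "S \<subseteq> V"
    and "k_gate k S (induced_edges E S)"
  shows "\<exists>q Q. card Q = k \<and> multipie VT ET P S q Q"
proof -
  let ?E = "induced_edges E S"
  obtain W :: "nat set" and F n where R: "root_graph W F" and L: "line_graph S ?E F n"
    using gate_line_graph assms(4) unfolding k_gate_def by blast
  have T: "is_tree VT ET" using assms(2) by (simp add: EPT_rep_def)
  have paths: "is_path VT ET (P v)" if "v \<in> S" for v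
    using assms(2,3) that by (auto simp: EPT_rep_def)
  have adj: "{u, v} \<in> ?E \<longleftrightarrow> path_edges (P u) \<inter> path_edges (P v) \<noteq> {}"
    if "u \<in> S" "v \<in> S" "u \<noteq> v" for u v
  proof -
    have "{u, v} \<in> ?E \<longleftrightarrow> {u, v} \<in> E" using that by (simp add: induced_edges_def)
    then show ?thesis using assms(2,3) that unfolding EPT_rep_def by (metis subsetD)
  qed
  obtain q where "q \<in> VT" "\<And>v. v \<in> S \<Longrightarrow> q \<in> set (P v)"
    using ex_pie_center[OF R L T paths adj] by blast
  then obtain Q where "card Q = card W" "multipie VT ET P S q Q"
    using ex_multipie[OF R L T paths adj] by blast
  moreover have "card W = k"
    using card_line_graph_cliques[OF R L] assms(4) by (simp add: k_gate_def)
  ultimately show ?thesis by blast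
qed

end
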